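(* For every $x>0$, the mapping $\alpha\mapsto E_\alpha(x^\alpha)$ is decreasing on $(0,2)$.
   Context: For $\alpha>0$, $E_\alpha$ denotes the Mittag-Leffler function $E_\alpha(z)=\sum_{n\ge 0} \frac{z^n}{\Gamma(1+n\alpha)}$, where $\Gamma$ is the Gamma function. *)

theory Defs
  imports "HOL-Analysis.Analysis"
begin

definition mittag_leffler :: "real \<Rightarrow> real \<Rightarrow> real" where
  "mittag_leffler \<alpha> z = (\<Sum>n. z ^ n / Gamma (1 + real n * \<alpha>))"

end

theory Submission
  imports Defs "HOL-Complex_Analysis.Complex_Analysis" "HOL-Real_Asymp.Real_Asymp"
begin

text \<open>
  Put \<open>q\<^sub>\<alpha>(s) = sin (\<pi>\<alpha>) / (2\<pi> (cosh (\<alpha>s) - cos (\<pi>\<alpha>)))\<close>. For \<open>0 < \<alpha> < 2\<close> and \<open>x \<ge> 0\<close>,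
  \<open>E\<^sub>\<alpha>(x\<^sup>\<alpha>) = e\<^sup>x / \<alpha> - \<integral> exp (- x e\<^sup>s) q\<^sub>\<alpha>(s) ds\<close>: the Laplace transforms of the two sides agree
  (the one of the integral is computed with the residue theorem on a rectangle), and a continuous
  function is determined by its Laplace transform at the integers (Weierstrass approximation).

  Hence \<open>\<phi>(x) = E\<^sub>\<alpha>(x\<^sup>\<alpha>) - E\<^sub>\<beta>(x\<^sup>\<beta>)\<close> is the integral of \<open>r \<mapsto> exp (- x r)\<close> against a signed measure with a positive
  atom at \<open>r = -1\<close> and density \<open>q\<^sub>\<beta> - q\<^sub>\<alpha>\<close> in \<open>s = ln r\<close>; its total mass is \<open>\<phi>(0) = 0\<close>.
  For \<open>\<alpha> \<le> 1\<close> the density is nonpositive and \<open>\<phi>(x) > 0\<close> follows at once. For \<open>\<alpha> > 1\<close>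
  the density is nonpositive for \<open>\<bar>s\<bar> \<le> s\<^sub>0\<close> and nonnegative for \<open>\<bar>s\<bar> \<ge> s\<^sub>0\<close>. Choose a small \<open>\<epsilon> < x\<close>;
  then \<open>exp (- x r)\<close> is a convex increasing function of \<open>y = exp (- \<epsilon> r)\<close>, and comparing it with its chord
  \<open>a + m y\<close> through the points \<open>r = exp (\<plusminus>s\<^sub>0)\<close> gives \<open>\<phi>(x) \<ge> a \<phi>(0) + m \<phi>(\<epsilon>) = m \<phi>(\<epsilon>)\<close>,
  while \<open>\<phi>(\<epsilon>) > 0\<close> can be read off the power series.
\<close>

section \<open>The Stieltjes transform of the kernel\<close>

text \<open>In the variable r = exp s, with ds = dr / r, this is the classical spectral density sin
  (pi \<alpha>) / pi * r^(\<alpha> - 1) / (r^(2 \<alpha>) - 2 r^\<alpha> cos (pi \<alpha>) + 1) of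
  the Mittag-Leffler function. The logarithmic variable makes it even.\<close>

definition ml_kernel :: "real \<Rightarrow> real \<Rightarrow> real" where
  "ml_kernel \<alpha> s = sin (pi * \<alpha>) / (2 * pi * (cosh (\<alpha> * s) - cos (pi * \<alpha>)))"

lemma cos_pi_mult_less_1:
  fixes \<alpha> :: real
  assumes "0 < \<alpha>" "\<alpha> < 2"
  shows "cos (pi * \<alpha>) < 1"
proof (rule ccontr)
  assume "\<not> cos (pi * \<alpha>) < 1"
  hence "cos (pi * \<alpha>) = 1"
    by (meson cos_le_one less_eq_real_def)
  then obtain n :: int where "pi * \<alpha> = of_int n * 2 * pi"
    using cos_one_2pi_int by auto
  hence "\<alpha> = of_int (2 * n)" by simp
  with assms have "0 < 2 * n" "2 * n < 2" by linarith+
  thus False by presburger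
qed

lemma ml_kernel_denom_pos:
  assumes "0 < \<alpha>" "\<alpha> < 2"
  shows "0 < cosh (\<alpha> * s) - cos (pi * \<alpha>)"
  using cos_pi_mult_less_1[OF assms] cosh_real_ge_1[of "\<alpha> * s"] by linarith

text \<open>Conjugate Poisson kernel: with \<rho> = exp (- t) the left side is \<rho> sin \<theta> /
  (1 - 2 \<rho> cos \<theta> + \<rho>^2), and dividing through by \<rho> brings in cosh t. For t =
  \<alpha> s and \<theta> = pi \<alpha> the result is pi times the kernel.\<close>

lemma Im_inverse_one_minus_exp:
  fixes t \<theta> :: real
  assumes "cos \<theta> < 1"
  shows "Im (inverse (1 - exp (of_real (- t) + \<i> * of_real \<theta>))) = sin \<theta> / (2 * (cosh t - cos \<theta>))"
proof -
  define \<rho> where "\<rho> = exp (- t)"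
  have \<rho>: "\<rho> > 0" unfolding \<rho>_def by simp
  have c: "cosh t = (\<rho> + 1 / \<rho>) / 2"
    by (simp add: cosh_def \<rho>_def exp_minus field_simps)
  have 1: "(1 - \<rho> * cos \<theta>)\<^sup>2 + (\<rho> * sin \<theta>)\<^sup>2 = 1 - 2 * \<rho> * cos \<theta> + \<rho>\<^sup>2"
    using sin_cos_squared_add[of \<theta>] by algebra
  have 2: "1 - 2 * \<rho> * cos \<theta> + \<rho>\<^sup>2 = \<rho> * (2 * (cosh t - cos \<theta>))"
    using \<rho> by (simp add: c field_simps power2_eq_square)
  have e: "exp (of_real (- t) + \<i> * of_real \<theta>) = of_real \<rho> * cis \<theta>"
    by (simp only: exp_add \<rho>_def cis_conv_exp exp_of_real)
  have "Im (inverse (1 - exp (of_real (- t) + \<i> * of_real \<theta>)))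
        = \<rho> * sin \<theta> / ((1 - \<rho> * cos \<theta>)\<^sup>2 + (\<rho> * sin \<theta>)\<^sup>2)"
    unfolding e by simp
  also have "\<dots> = \<rho> * sin \<theta> / (\<rho> * (2 * (cosh t - cos \<theta>)))"
    unfolding 1 2 ..
  also have "\<dots> = sin \<theta> / (2 * (cosh t - cos \<theta>))"
    using \<rho> by simp
  finally show ?thesis .
qed

text \<open>\<open>lam\<close> is the Laplace variable. The condition \<open>1 < lam\<close> makes
  the Laplace transform of exp x finite and keeps the two poles 0 and \<open>\<i> * ln lam\<close>
  apart.\<close>

locale kernel_stieltjes =
  fixes \<alpha> lam :: real
  assumes \<alpha>: "0 < \<alpha>" "\<alpha> < 2" and lam: "1 < lam"
begin

text \<open>On the two lines \<open>Re w = \<plusminus> pi\<close> the factor \<open>exp (- \<i> * w)\<close> is \<open>- exp (Im w)\<close>, and the jump of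
  \<open>1 / g\<close> between them is the integrand \<open>ml_kernel \<alpha> s / (lam + exp s)\<close> up to a constant.\<close>

definition g where "g w = (1 - exp (\<i> * of_real \<alpha> * w)) * (exp (- \<i> * w) - of_real lam)" for w :: complex

definition f where "f w = 1 / g w" for w

text \<open>The zeros of \<open>g\<close> off the imaginary axis have \<open>\<bar>Re w\<bar> \<ge> c\<close>; that \<open>c > pi\<close> is where \<open>\<alpha> < 2\<close> is needed.\<close>

definition c where "c = min (2 * pi) (2 * pi / \<alpha>)"

lemma pi_less_c: "pi < c"
  using \<alpha> by (auto simp: c_def field_simps)

text \<open>The first factor of \<open>g\<close> vanishes at the real points 2 pi n / \<alpha>, the
  second at the points \<open>\<i> * ln lam\<close> - 2 pi n. In the strip only n = 0
  remains.\<close>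

lemma g_zero_iff:
  assumes "\<bar>Re w\<bar> < c"
  shows "g w = 0 \<longleftrightarrow> w = 0 \<or> w = \<i> * of_real (ln lam)"
proof
  assume "g w = 0"
  then consider "exp (\<i> * of_real \<alpha> * w) = exp 0" | "exp (- \<i> * w) = of_real lam"
    by (auto simp: g_def)
  thus "w = 0 \<or> w = \<i> * of_real (ln lam)"
  proof cases
    case 1
    then obtain n :: int where n: "\<i> * of_real \<alpha> * w = 0 + (of_int (2 * n) * pi) * \<i>"
      unfolding exp_eq by auto
    have "\<alpha> * Re w = 2 * n * pi" "\<alpha> * Im w = 0"
      using arg_cong[OF n, of Im] arg_cong[OF n, of Re] by simp_all
    hence re: "\<alpha> * Re w = 2 * n * pi" and im: "Im w = 0" using \<alpha> by simp_all
    have "\<alpha> * \<bar>Re w\<bar> < 2 * pi" using assms \<alpha> by (simp add: c_def field_simps)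
    moreover have "\<alpha> * \<bar>Re w\<bar> = \<bar>2 * n * pi\<bar>" unfolding re[symmetric] using \<alpha> by (simp add: abs_mult)
    ultimately have "\<bar>real_of_int n\<bar> < 1" by (simp add: abs_mult)
    hence "n = 0" by linarith
    with re \<alpha> have "Re w = 0" by simp
    with im show ?thesis by (simp add: complex_eq_iff)
  next
    case 2
    hence "exp (- \<i> * w) = exp (of_real (ln lam))" using lam by (simp add: exp_of_real)
    then obtain n :: int where n: "- \<i> * w = of_real (ln lam) + (of_int (2 * n) * pi) * \<i>"
      unfolding exp_eq by auto
    have re: "Re w = - 2 * n * pi" and im: "Im w = ln lam"
      using arg_cong[OF n, of Im] arg_cong[OF n, of Re] by simp_all
    have "\<bar>Re w\<bar> < 2 * pi" using assms by (simp add: c_def)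
    hence "\<bar>real_of_int n\<bar> < 1" unfolding re by (simp add: abs_mult)
    hence "n = 0" by linarith
    with re im show ?thesis by (simp add: complex_eq_iff)
  qed
next
  assume "w = 0 \<or> w = \<i> * of_real (ln lam)"
  thus "g w = 0"
    using lam by (auto simp: g_def exp_of_real)
qed

section \<open>Residues of \<open>f\<close> at its two poles in the strip\<close>

definition S where "S = {w :: complex. \<bar>Re w\<bar> < c}"

lemma open_S: "open S"
  unfolding S_def by (intro open_Collect_less continuous_intros)

lemma connected_S: "connected S"
proof -
  have "S = {w. Re w < c} \<inter> {w. Re w > - c}" by (auto simp: S_def abs_less_iff)
  thus ?thesis
    by (auto intro!: convex_connected convex_Int convex_halfspace_Re_lt convex_halfspace_Re_gt)
qed

lemma holomorphic_f: "f holomorphic_on S - {0, \<i> * of_real (ln lam)}"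
  unfolding f_def
proof (intro holomorphic_intros)
  show "g holomorphic_on S - {0, \<i> * of_real (ln lam)}"
    unfolding g_def by (intro holomorphic_intros)
  show "g z \<noteq> 0" if "z \<in> S - {0, \<i> * of_real (ln lam)}" for z
    using g_zero_iff[of z] that by (auto simp: S_def)
qed

lemma residue_f:
  assumes "(g has_field_derivative g') (at z)" "g' \<noteq> 0" "z \<in> {0, \<i> * of_real (ln lam)}"
  shows "residue f z = 1 / g'"
  unfolding f_def
proof (rule residue_simple_pole_deriv[where s = S])
  show "g holomorphic_on S" unfolding g_def by (intro holomorphic_intros)
  show "z \<in> S" using assms pi_less_c pi_gt_zero unfolding S_def by (auto simp del: pi_gt_zero)
  thus "g z = 0" using assms g_zero_iff[of z] by (auto simp: S_def)
qed (use assms open_S connected_S in auto)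

lemma residue_f_0: "residue f 0 = \<i> * of_real (1 / (\<alpha> * (1 - lam)))"
proof -
  have "(g has_field_derivative (- \<i> * of_real (\<alpha> * (1 - lam)))) (at 0)"
    unfolding g_def by (auto intro!: derivative_eq_intros simp: algebra_simps)
  moreover have "- \<i> * of_real (\<alpha> * (1 - lam)) \<noteq> 0"
    using \<alpha> lam by (auto simp flip: of_real_diff simp del: of_real_diff)
  ultimately have "residue f 0 = 1 / (- \<i> * of_real (\<alpha> * (1 - lam)))"
    by (intro residue_f) auto
  also have "\<dots> = \<i> * of_real (1 / (\<alpha> * (1 - lam)))"
    unfolding of_real_divide of_real_1 by (simp add: divide_simps)
  finally show ?thesis .
qed

lemma residue_f_ln:
  "residue f (\<i> * of_real (ln lam)) = \<i> * of_real (1 / (lam * (1 - lam powr - \<alpha>)))"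
proof -
  let ?z = "\<i> * of_real (ln lam)"
  have e1: "exp (- \<i> * ?z) = of_real lam" using lam by (simp add: exp_of_real)
  have e2: "exp (\<i> * of_real \<alpha> * ?z) = of_real (lam powr - \<alpha>)"
    using lam by (simp add: powr_def algebra_simps exp_of_real [symmetric])
  have "(g has_field_derivative (- \<i> * of_real (lam * (1 - lam powr - \<alpha>)))) (at ?z)"
    unfolding g_def
    by (rule derivative_eq_intros refl | simp only: e1 e2)+ (simp add: algebra_simps)
  moreover have l1: "lam powr - \<alpha> < 1" using \<alpha> lam by (simp add: powr_less_one)
  hence "- \<i> * of_real (lam * (1 - lam powr - \<alpha>)) \<noteq> 0"
    using \<alpha> lam by (simp flip: of_real_diff del: of_real_diff)
  ultimately have "residue f ?z = 1 / (- \<i> * of_real (lam * (1 - lam powr - \<alpha>)))"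
    by (intro residue_f) auto
  also have "\<dots> = \<i> * of_real (1 / (lam * (1 - lam powr - \<alpha>)))"
    unfolding of_real_divide of_real_1 by (simp add: divide_simps)
  finally show ?thesis .
qed

text \<open>The value at \<open>lam\<close> of the Laplace transform of exp x / \<alpha> minus that
  of the Mittag-Leffler term; the two summands are computed in \<open>nn_integral_exp_over\<close>
  and \<open>nn_integral_mittag_leffler\<close>.\<close>

definition L where "L = 1 / (\<alpha> * (lam - 1)) - 1 / (lam * (1 - lam powr - \<alpha>))"

text \<open>For R > ln lam both poles lie inside the rectangle, and their residues add up to
  \<open>- \<i> * L\<close>. The second claim gives the continuity of \<open>f\<close> along the
  sides.\<close>

lemma contour_integral_rectpath_f:
  assumes "R > ln lam"
  shows "contour_integral (rectpath (Complex (- pi) (- R)) (Complex pi R)) f = of_real (2 * pi * L)"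
    "path_image (rectpath (Complex (- pi) (- R)) (Complex pi R)) \<subseteq> S - {0, \<i> * of_real (ln lam)}"
proof -
  define z1 z2 where "z1 = Complex (- pi) (- R)" and "z2 = Complex pi R"
  have R: "R > 0" using assms lam ln_gt_zero[of lam] by linarith
  have ll: "ln lam > 0" using lam by simp
  have box: "{0, \<i> * of_real (ln lam)} \<subseteq> box z1 z2"
    using assms R ll by (auto simp: in_box_complex_iff z1_def z2_def)
  have sub: "path_image (rectpath z1 z2) \<subseteq> cbox z1 z2 - box z1 z2"
    using R by (subst path_image_rectpath_cbox_minus_box) (auto simp: z1_def z2_def)
  have cb: "cbox z1 z2 \<subseteq> S"
    using pi_less_c by (auto simp: in_cbox_complex_iff z1_def z2_def S_def)
  show sub2: "path_image (rectpath z1 z2) \<subseteq> S - {0, \<i> * of_real (ln lam)}"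
    using sub box cb by blast
  have "contour_integral (rectpath z1 z2) f = 2 * pi * \<i> *
     (\<Sum>p\<in>{0, \<i> * of_real (ln lam)}. winding_number (rectpath z1 z2) p * residue f p)"
  proof (rule Residue_theorem[OF open_S connected_S _ holomorphic_f])
    show "\<forall>z. z \<notin> S \<longrightarrow> winding_number (rectpath z1 z2) z = 0"
      using cb R by (intro allI impI winding_number_rectpath_outside) (auto simp: z1_def z2_def)
  qed (use sub2 in auto)
  also have "(\<Sum>p\<in>{0, \<i> * of_real (ln lam)}. winding_number (rectpath z1 z2) p * residue f p)
     = (\<Sum>p\<in>{0, \<i> * of_real (ln lam)}. residue f p)"
    using box by (intro sum.cong refl) (metis mult_1 subsetD winding_number_rectpath)
  also have "\<dots> = residue f 0 + residue f (\<i> * of_real (ln lam))"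
    using ll by (subst sum.insert) auto
  also have "2 * pi * \<i> * \<dots> = of_real (2 * pi * L)"
  proof -
    have "1 / (\<alpha> * (1 - lam)) = - (1 / (\<alpha> * (lam - 1)))"
      using lam \<alpha> by (simp add: divide_simps)
    thus ?thesis
    unfolding residue_f_0 residue_f_ln L_def
    by (simp add: algebra_simps)
  qed
  finally show "contour_integral (rectpath z1 z2) f = of_real (2 * pi * L)" .
qed

text \<open>The two values of \<open>f\<close> are complex conjugates, so their difference is 2
  \<open>\<i>\<close> times an imaginary part, which \<open>Im_inverse_one_minus_exp\<close>
  evaluates.\<close>

lemma f_vertical:
  "f (Complex pi s) - f (Complex (- pi) s) = - 2 * pi * \<i> * of_real (ml_kernel \<alpha> s / (lam + exp s))"
proof -
  let ?E = "\<lambda>t::real. 1 - exp (of_real (- (\<alpha> * s)) + \<i> * of_real t)"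
  have f1: "f (Complex t s) = - (inverse (?E (t * \<alpha>)) * of_real (1 / (lam + exp s)))"
    if "t = pi \<or> t = - pi" for t
  proof -
    have "- \<i> * Complex t s = of_real s + - \<i> * of_real t" by (simp add: Complex_eq algebra_simps)
    hence "exp (- \<i> * Complex t s) = exp (of_real s) * exp (- \<i> * of_real t)" by (simp only: exp_add)
    also have "exp (- \<i> * of_real t) = - 1"
      using that by (auto simp: exp_minus mult.commute)
    finally have "exp (- \<i> * Complex t s) = - of_real (exp s)" by (simp add: exp_of_real)
    moreover have "\<i> * of_real \<alpha> * Complex t s = of_real (- (\<alpha> * s)) + \<i> * of_real (t * \<alpha>)"
      by (simp add: Complex_eq algebra_simps)
    ultimately have "f (Complex t s) = 1 / (?E (t * \<alpha>) * (- of_real (exp s) - of_real lam))"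
      unfolding f_def g_def by metis
    also have "- of_real (exp s) - of_real lam = - (of_real (lam + exp s) :: complex)" by simp
    finally show ?thesis by (simp add: divide_inverse del: of_real_add)
  qed
  have "cnj (of_real (- (\<alpha> * s)) + \<i> * of_real (pi * \<alpha>)) =
      of_real (- (\<alpha> * s)) + \<i> * of_real (- pi * \<alpha>)"
    by (simp add: complex_eq_iff)
  hence cnj: "?E (- pi * \<alpha>) = cnj (?E (pi * \<alpha>))"
    by (simp only: complex_cnj_diff complex_cnj_one exp_cnj)
  define A where "A = inverse (?E (pi * \<alpha>))"
  have "f (Complex pi s) = - (A * of_real (1 / (lam + exp s)))"
    using f1[of pi] by (simp only: A_def simp_thms)
  moreover have "f (Complex (- pi) s) = - (cnj A * of_real (1 / (lam + exp s)))"
    using f1[of "- pi"] by (simp only: A_def cnj complex_cnj_inverse simp_thms)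
  ultimately have "f (Complex pi s) - f (Complex (- pi) s) = - ((A - cnj A) * of_real (1 / (lam + exp s)))"
    by (simp add: diff_divide_distrib)
  also have "A - cnj A = of_real (2 * Im A) * \<i>"
    by (simp add: complex_eq_iff)
  also have "Im A = pi * ml_kernel \<alpha> s"
    unfolding A_def using cos_pi_mult_less_1[OF \<alpha>]
    by (subst Im_inverse_one_minus_exp) (simp_all add: ml_kernel_def)
  finally show ?thesis by simp
qed

section \<open>Decay of \<open>f\<close> on the horizontal sides\<close>

lemma norm_f_top:
  assumes "R > ln lam" "Im w = R"
  shows "norm (f w) \<le> 1 / ((1 - exp (- \<alpha> * R)) * (exp R - lam))"
proof -
  have R: "R > 0" using assms lam ln_gt_zero[of lam] by linarith
  have 1: "exp (- \<alpha> * R) < 1" using \<alpha> R by simp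
  have 2: "exp R > lam" using assms lam by (metis exp_less_cancel_iff exp_ln less_trans zero_less_one)
  have n1: "norm (exp (\<i> * of_real \<alpha> * w)) = exp (- \<alpha> * R)"
    and n2: "norm (exp (- \<i> * w)) = exp R" unfolding norm_exp_eq_Re using assms by auto
  have "norm (1 - exp (\<i> * of_real \<alpha> * w)) \<ge> 1 - exp (- \<alpha> * R)"
    using norm_triangle_ineq2[of 1 "exp (\<i> * of_real \<alpha> * w)"] unfolding n1 norm_one .
  moreover have "norm (exp (- \<i> * w) - of_real lam) \<ge> exp R - lam"
    using norm_triangle_ineq2[of "exp (- \<i> * w)" "of_real lam"] lam unfolding n2 norm_of_real by simp
  ultimately have "norm (g w) \<ge> (1 - exp (- \<alpha> * R)) * (exp R - lam)"
    unfolding g_def norm_mult using 1 2 by (intro mult_mono) auto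
  moreover have "(1 - exp (- \<alpha> * R)) * (exp R - lam) > 0" using 1 2 by simp
  ultimately show ?thesis unfolding f_def norm_divide norm_one
    by (intro divide_left_mono) (auto intro!: mult_pos_pos)
qed

text \<open>Compared with the top side the factors exchange roles: the first now grows like exp
  (\<alpha> R), while the norm of the second stays near \<open>lam\<close>.\<close>

lemma norm_f_bottom:
  assumes "R > 0" "Im w = - R"
  shows "norm (f w) \<le> 1 / ((exp (\<alpha> * R) - 1) * (lam - exp (- R)))"
proof -
  have 1: "exp (\<alpha> * R) > 1" using \<alpha> assms by simp
  have 2: "exp (- R) < lam" using assms lam by (smt (verit) exp_less_one_iff)
  have n1: "norm (exp (\<i> * of_real \<alpha> * w)) = exp (\<alpha> * R)"
    and n2: "norm (exp (- \<i> * w)) = exp (- R)" unfolding norm_exp_eq_Re using assms by auto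
  have "norm (1 - exp (\<i> * of_real \<alpha> * w)) \<ge> exp (\<alpha> * R) - 1"
    using norm_triangle_ineq2[of "exp (\<i> * of_real \<alpha> * w)" 1] unfolding n1 norm_one norm_minus_commute[of 1] .
  moreover have "norm (exp (- \<i> * w) - of_real lam) \<ge> lam - exp (- R)"
    using norm_triangle_ineq2[of "of_real lam" "exp (- \<i> * w)"] lam
    unfolding n2 norm_of_real norm_minus_commute[of "of_real lam"] by simp
  ultimately have "norm (g w) \<ge> (exp (\<alpha> * R) - 1) * (lam - exp (- R))"
    unfolding g_def norm_mult using 1 2 by (intro mult_mono) auto
  moreover have "(exp (\<alpha> * R) - 1) * (lam - exp (- R)) > 0" using 1 2 by simp
  ultimately show ?thesis unfolding f_def norm_divide norm_one
    by (intro divide_left_mono) (auto intro!: mult_pos_pos)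
qed

lemma continuous_on_kernel_div: "continuous_on A (\<lambda>s. ml_kernel \<alpha> s / (lam + exp s))"
proof -
  have "cosh (\<alpha> * s) - cos (pi * \<alpha>) \<noteq> 0" "lam + exp s \<noteq> 0" for s :: real
    using ml_kernel_denom_pos[OF \<alpha>, of s] lam exp_gt_zero[of s] by linarith+
  thus ?thesis unfolding ml_kernel_def by (intro continuous_intros) auto
qed

text \<open>The vertical sides together contribute 2 pi times the integral of the kernel, by the
  jump of \<open>f\<close>. Each horizontal side has length 2 pi, so the bounds on \<open>f\<close>
  enter with the same factor, which cancels.\<close>

lemma integral_kernel_div_error:
  assumes "R > ln lam"
  shows "\<bar>integral {-R..R} (\<lambda>s. ml_kernel \<alpha> s / (lam + exp s)) - L\<bar>
     \<le> 1 / ((1 - exp (- \<alpha> * R)) * (exp R - lam)) + 1 / ((exp (\<alpha> * R) - 1) * (lam - exp (- R)))"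
    (is "\<bar>?I - L\<bar> \<le> ?B1 + ?B2")
proof -
  have R: "R > 0" using assms lam ln_gt_zero[of lam] by linarith
  define z1 z2 z3 z4 where "z1 = Complex (- pi) (- R)" and "z2 = Complex pi (- R)"
    and "z3 = Complex pi R" and "z4 = Complex (- pi) R"
  have rp: "rectpath z1 z3 = linepath z1 z2 +++ linepath z2 z3 +++ linepath z3 z4 +++ linepath z4 z1"
    by (simp add: rectpath_def Let_def z1_def z2_def z3_def z4_def)
  have sub: "path_image (rectpath z1 z3) \<subseteq> S - {0, \<i> * of_real (ln lam)}"
    using contour_integral_rectpath_f(2)[OF assms] by (simp add: z1_def z3_def)
  have cont: "continuous_on (S - {0, \<i> * of_real (ln lam)}) f"
    using holomorphic_f by (rule holomorphic_on_imp_continuous_on)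
  have ci: "f contour_integrable_on linepath u v"
    if "path_image (linepath u v) \<subseteq> path_image (rectpath z1 z3)" for u v
    using that sub by (intro contour_integrable_continuous_linepath continuous_on_subset[OF cont]) auto
  have i12: "f contour_integrable_on linepath z1 z2"
    and i23: "f contour_integrable_on linepath z2 z3"
    and i34: "f contour_integrable_on linepath z3 z4"
    and i41: "f contour_integrable_on linepath z4 z1"
    by (rule ci, simp add: rp path_image_join subset_iff)+
  have "contour_integral (rectpath z1 z3) f =
     contour_integral (linepath z1 z2) f + contour_integral (linepath z2 z3) f +
     contour_integral (linepath z3 z4) f + contour_integral (linepath z4 z1) f"
    unfolding rp using i12 i23 i34 i41 by (simp add: contour_integrable_joinI)
  also have "contour_integral (linepath z4 z1) f = - contour_integral (linepath z1 z4) f"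
    using i41 by (metis contour_integral_reverse_linepath contour_integrable_reversepath
      contour_integral_reversepath reversepath_linepath valid_path_linepath)
  also have "contour_integral (linepath z1 z4) f = \<i> * integral {-R..R} (\<lambda>s. f (Complex (- pi) s))"
    using R by (intro contour_integral_linepath_same_Re) (auto simp: z1_def z4_def)
  also have "contour_integral (linepath z2 z3) f = \<i> * integral {-R..R} (\<lambda>s. f (Complex pi s))"
    using R by (intro contour_integral_linepath_same_Re) (auto simp: z2_def z3_def)
  finally have eq: "of_real (2 * pi * L) = contour_integral (linepath z1 z2) f
     + contour_integral (linepath z3 z4) f + \<i> * (integral {-R..R} (\<lambda>s. f (Complex pi s)) -
      integral {-R..R} (\<lambda>s. f (Complex (- pi) s)))"
    using contour_integral_rectpath_f(1)[OF assms] by (simp add: z1_def z3_def algebra_simps)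
  have int: "(\<lambda>s. f (Complex t s)) integrable_on {-R..R}" if "t = pi \<or> t = - pi" for t
  proof (rule integrable_continuous_interval)
    have "continuous_on {-R..R} (f \<circ> (\<lambda>s. Complex t s))"
    proof (rule continuous_on_compose)
      have "(\<lambda>s. Complex t s) ` {-R..R} \<subseteq> path_image (rectpath z1 z3)"
        using that R by (subst path_image_rectpath) (auto simp: z1_def z3_def)
      thus "continuous_on ((\<lambda>s. Complex t s) ` {-R..R}) f"
        using sub by (intro continuous_on_subset[OF cont]) auto
    qed (auto simp: Complex_eq intro!: continuous_intros)
    thus "continuous_on {-R..R} (\<lambda>s. f (Complex t s))" by (simp add: o_def)
  qed
  have "integral {-R..R} (\<lambda>s. f (Complex pi s)) - integral {-R..R} (\<lambda>s. f (Complex (- pi) s))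
      = integral {-R..R} (\<lambda>s. f (Complex pi s) - f (Complex (- pi) s))"
    by (rule integral_diff [symmetric]) (auto intro: int)
  also have "\<dots> = integral {-R..R} (\<lambda>s. - 2 * pi * \<i> * of_real (ml_kernel \<alpha> s / (lam + exp s)))"
    by (simp only: f_vertical)
  also have "\<dots> = - 2 * pi * \<i> * integral {-R..R} (\<lambda>s. of_real (ml_kernel \<alpha> s / (lam + exp s)))"
    by (rule integral_mult_right)
  finally have 1: "integral {-R..R} (\<lambda>s. f (Complex pi s)) - integral {-R..R} (\<lambda>s. f (Complex (- pi) s))
      = - 2 * pi * \<i> * integral {-R..R} (\<lambda>s. of_real (ml_kernel \<alpha> s / (lam + exp s)))" .
  have 2: "integral {-R..R} (\<lambda>s. complex_of_real (ml_kernel \<alpha> s / (lam + exp s))) = of_real ?I"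
    by (intro integral_unique has_integral_of_real integrable_integral
          integrable_continuous_interval continuous_on_kernel_div)
  have "of_real (2 * pi * L) = contour_integral (linepath z1 z2) f
     + contour_integral (linepath z3 z4) f + \<i> * (- 2 * pi * \<i> * of_real ?I)"
    using eq unfolding 1 2 .
  hence "of_real (2 * pi * (L - ?I)) = contour_integral (linepath z1 z2) f
     + contour_integral (linepath z3 z4) f"
    by (simp add: algebra_simps)
  hence "\<bar>2 * pi * (L - ?I)\<bar> = norm (contour_integral (linepath z1 z2) f
     + contour_integral (linepath z3 z4) f)"
    by (metis norm_of_real)
  also have "\<dots> \<le> norm (contour_integral (linepath z1 z2) f) + norm (contour_integral (linepath z3 z4) f)"
    by (rule norm_triangle_ineq)
  also have "\<dots> \<le> ?B2 * norm (z2 - z1) + ?B1 * norm (z4 - z3)"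
  proof (intro add_mono contour_integral_bound_linepath i12 i34)
    fix w assume "w \<in> closed_segment z1 z2"
    hence "Im w = - R" using closed_segment_same_Im[of z1 z2] R by (auto simp: z1_def z2_def)
    thus "norm (f w) \<le> ?B2" using R by (intro norm_f_bottom) auto
  next
    fix w assume "w \<in> closed_segment z3 z4"
    hence "Im w = R" using closed_segment_same_Im[of z3 z4] R by (auto simp: z3_def z4_def)
    thus "norm (f w) \<le> ?B1" using assms by (intro norm_f_top) auto
  next
    \<comment> \<open>The bounds are nonnegative because they dominate the norm of \<open>f\<close>
      at the midpoints of the two horizontal sides.\<close>
    have "Im (\<i> * R) = R" "Im (- \<i> * R) = - R" by auto
    thus "0 \<le> ?B1" "0 \<le> ?B2" using norm_f_top[OF assms, of "\<i> * R"] norm_f_bottom[OF R, of "- \<i> * R"]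
      norm_ge_zero order_trans by blast+
  qed
  also have "norm (z2 - z1) = 2 * pi"
    by (simp add: z1_def z2_def cmod_def real_sqrt_mult)
  also have "norm (z4 - z3) = 2 * pi"
    by (simp add: z3_def z4_def cmod_def real_sqrt_mult)
  also have "?B2 * (2 * pi) + ?B1 * (2 * pi) = 2 * pi * (?B1 + ?B2)"
    by (simp only: ring_distribs mult_ac add_ac)
  also have "\<bar>2 * pi * (L - ?I)\<bar> = 2 * pi * \<bar>L - ?I\<bar>"
    by (simp add: abs_mult)
  finally have "\<bar>L - ?I\<bar> \<le> ?B1 + ?B2"
    by (rule mult_left_le_imp_le) simp
  thus ?thesis by (simp add: abs_minus_commute)
qed

lemma integral_kernel_div_tendsto:
  "((\<lambda>R. integral {-R..R} (\<lambda>s. ml_kernel \<alpha> s / (lam + exp s))) \<longlongrightarrow> L) at_top"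
proof (rule Lim_transform2)
  let ?B = "\<lambda>R::real. 1 / ((1 - exp (- \<alpha> * R)) * (exp R - lam)) + 1 / ((exp (\<alpha> * R) - 1) * (lam - exp (- R)))"
  have B: "(?B \<longlongrightarrow> 0) at_top"
  proof -
    have *: "\<alpha> > 0" "lam > 0" using \<alpha> lam by auto
    have "((\<lambda>R. 1 / ((1 - exp (- \<alpha> * R)) * (exp R - lam))) \<longlongrightarrow> 0) at_top" using * by real_asymp
    moreover have "((\<lambda>R. 1 / ((exp (\<alpha> * R) - 1) * (lam - exp (- R)))) \<longlongrightarrow> 0) at_top" using * by real_asymp
    ultimately show ?thesis by (rule tendsto_add_zero)
  qed
  show "((\<lambda>R. L - integral {-R..R} (\<lambda>s. ml_kernel \<alpha> s / (lam + exp s))) \<longlongrightarrow> 0) at_top"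
    by (rule Lim_null_comparison[OF _ B], rule eventually_mono[OF eventually_gt_at_top[of "ln lam"]])
       (use integral_kernel_div_error in \<open>auto simp: abs_minus_commute\<close>)
qed simp

end

section \<open>Uniqueness for Laplace transforms at integers\<close>

text \<open>With y = exp (- x) the hypotheses say that a signed density on (0, 1] has vanishing
  moments. By Weierstrass approximation it then annihilates a continuous bump in y living where u >
  v, which is impossible. The moments start at n = 2 because exp x has no finite Laplace transform
  at 1. The reverse inequality follows by symmetry.\<close>

lemma laplace_le_if_moments_eq:
  fixes u v :: "real \<Rightarrow> real"
  assumes cont: "continuous_on {0..} u" "continuous_on {0..} v"
    and nonneg: "\<And>x. 0 \<le> x \<Longrightarrow> 0 \<le> u x" "\<And>x. 0 \<le> x \<Longrightarrow> 0 \<le> v x"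
    and eq: "\<And>n. 2 \<le> n \<Longrightarrow> (\<integral>\<^sup>+x. ennreal (exp (- real n * x) * u x) * indicator {0..} x \<partial>lborel)
                = (\<integral>\<^sup>+x. ennreal (exp (- real n * x) * v x) * indicator {0..} x \<partial>lborel)"
    and fin: "\<And>n. 2 \<le> n \<Longrightarrow> (\<integral>\<^sup>+x. ennreal (exp (- real n * x) * u x) * indicator {0..} x \<partial>lborel) < \<infinity>"
    and x0: "0 \<le> x0"
  shows "u x0 \<le> v x0"
proof (rule ccontr)
  assume neg: "\<not> u x0 \<le> v x0"
  \<comment> \<open>The factor exp (- 2 x) absorbs the lowest admissible moment: \<open>G\<close>
    itself is integrable, and its k-th moment in exp (- x) is the Laplace transform at k +
    2.\<close>
  define G where "G x = (u x - v x) * exp (- 2 * x) * indicator {0..} x" for x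
  have meas: "(\<lambda>x. exp (- real n * x) * w x * indicator {0..} x) \<in> borel_measurable borel"
    if "continuous_on {0..} w" for n and w :: "real \<Rightarrow> real"
  proof -
    have "(\<lambda>x. indicator {0..} x *\<^sub>R (exp (- real n * x) * w x)) \<in> borel_measurable borel"
      using that by (intro borel_measurable_continuous_on_indicator continuous_intros) auto
    thus ?thesis by (simp add: mult_ac)
  qed
  have nn: "(\<integral>\<^sup>+x. ennreal (exp (- real n * x) * w x) * indicator {0..} x \<partial>lborel)
     = (\<integral>\<^sup>+x. ennreal (exp (- real n * x) * w x * indicator {0..} x) \<partial>lborel)" for n w
    by (intro nn_integral_cong) (auto simp: indicator_def)
  have int_u: "integrable lborel (\<lambda>x. exp (- real n * x) * u x * indicator {0..} x)" if "2 \<le> n" for n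
    using fin[OF that] meas[OF cont(1), of n] nonneg(1) unfolding nn
    by (intro integrableI_nonneg) (auto simp: indicator_def)
  have int_v: "integrable lborel (\<lambda>x. exp (- real n * x) * v x * indicator {0..} x)" if "2 \<le> n" for n
    using fin[OF that, unfolded eq[OF that]] meas[OF cont(2), of n] nonneg(2) unfolding nn
    by (intro integrableI_nonneg) (auto simp: indicator_def)
  have "integral\<^sup>L lborel (\<lambda>x. exp (- real n * x) * u x * indicator {0..} x) =
     integral\<^sup>L lborel (\<lambda>x. exp (- real n * x) * v x * indicator {0..} x)" if "2 \<le> n" for n
    using eq[OF that] meas[OF cont(1), of n] meas[OF cont(2), of n] nonneg unfolding nn
    by (subst (1 2) integral_eq_nn_integral) (auto simp: indicator_def)
  note eq_int = this
  have G_eq: "G x * exp (- x) ^ k = exp (- real (k + 2) * x) * u x * indicator {0..} x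
      - exp (- real (k + 2) * x) * v x * indicator {0..} x" for x k
  proof -
    have "exp (- 2 * x) * exp (- x) ^ k = exp (- real (k + 2) * x)"
      by (simp add: exp_of_nat_mult [symmetric] exp_add [symmetric] algebra_simps)
    thus ?thesis unfolding G_def by (simp add: algebra_simps)
  qed
  have G_k: "integrable lborel (\<lambda>x. G x * exp (- x) ^ k)"
      "integral\<^sup>L lborel (\<lambda>x. G x * exp (- x) ^ k) = 0" for k
    unfolding G_eq using int_u[of "k + 2"] int_v[of "k + 2"] eq_int[of "k + 2"]
    by (simp_all add: Bochner_Integration.integral_diff)
  have G_int: "integrable lborel G" using G_k(1)[of 0] by simp
  have G_0: "G x = 0" if "x < 0" for x using that by (simp add: G_def)
  have poly0: "integrable lborel (\<lambda>x. G x * p (exp (- x))) \<and> integral\<^sup>L lborel (\<lambda>x. G x * p (exp (- x))) = 0"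
    if p: "real_polynomial_function p" for p
  proof -
    obtain a n where p: "p = (\<lambda>x. \<Sum>i\<le>n. a i * x ^ i)"
      using p real_polynomial_function_iff_sum by blast
    have eq: "G x * p (exp (- x)) = (\<Sum>i\<le>n. a i * (G x * exp (- x) ^ i))" for x
      unfolding p sum_distrib_left by (simp add: mult_ac)
    show ?thesis unfolding eq using G_k
      by (auto intro!: Bochner_Integration.integrable_sum simp: Bochner_Integration.integral_sum)
  qed
  \<comment> \<open>Replacing h by a polynomial within e on [0, 1] costs at most e times the
    integral of the absolute value of \<open>G\<close>, and e is arbitrary. Outside x \<ge> 0, where
    exp (- x) leaves [0, 1], \<open>G\<close> vanishes.\<close>
  have cont0: "integral\<^sup>L lborel (\<lambda>x. G x * h (exp (- x))) = 0"
    if h: "continuous_on {0..1} h" "integrable lborel (\<lambda>x. G x * h (exp (- x)))" for h :: "real \<Rightarrow> real"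
  proof -
    have "\<bar>integral\<^sup>L lborel (\<lambda>x. G x * h (exp (- x)))\<bar> \<le> e * integral\<^sup>L lborel (\<lambda>x. \<bar>G x\<bar>)"
      if e: "e > 0" for e
    proof -
      obtain p where p: "real_polynomial_function p" "\<And>y. y \<in> {0..1} \<Longrightarrow> \<bar>h y - p y\<bar> < e"
        using Stone_Weierstrass_real_polynomial_function[OF _ h(1) e] by auto
      have "integral\<^sup>L lborel (\<lambda>x. G x * h (exp (- x)))
         = integral\<^sup>L lborel (\<lambda>x. G x * h (exp (- x)) - G x * p (exp (- x)))"
        using poly0[OF p(1)] h(2) by (subst Bochner_Integration.integral_diff) auto
      also have "\<bar>\<dots>\<bar> \<le> integral\<^sup>L lborel (\<lambda>x. \<bar>G x * h (exp (- x)) - G x * p (exp (- x))\<bar>)"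
        by (rule integral_abs_bound)
      also have "\<dots> \<le> integral\<^sup>L lborel (\<lambda>x. e * \<bar>G x\<bar>)"
      proof (rule integral_mono)
        show "\<bar>G x * h (exp (- x)) - G x * p (exp (- x))\<bar> \<le> e * \<bar>G x\<bar>" for x
        proof (cases "x < 0")
          case False
          hence "\<bar>h (exp (- x)) - p (exp (- x))\<bar> < e" by (intro p) auto
          thus ?thesis unfolding right_diff_distrib [symmetric] abs_mult
            by (subst mult.commute) (rule mult_right_mono, auto)
        qed (simp add: G_0)
      qed (use poly0[OF p(1)] h(2) G_int in auto)
      finally show ?thesis by simp
    qed
    note bound = this
    have "((\<lambda>e. e * integral\<^sup>L lborel (\<lambda>x. \<bar>G x\<bar>)) \<longlongrightarrow> 0 * integral\<^sup>L lborel (\<lambda>x. \<bar>G x\<bar>)) (at_right 0)"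
      by (intro tendsto_intros)
    hence "\<bar>integral\<^sup>L lborel (\<lambda>x. G x * h (exp (- x)))\<bar> \<le> 0 * integral\<^sup>L lborel (\<lambda>x. \<bar>G x\<bar>)"
      by (rule tendsto_lowerbound) (use bound in \<open>auto simp: eventually_at_right_less intro!: eventually_at_rightI[of 0 1]\<close>)
    thus ?thesis by simp
  qed
  \<comment> \<open>The interval is taken to the right of \<open>x0\<close>, so that it stays in the
    half-line even when \<open>x0\<close> is 0.\<close>
  obtain a b where ab: "0 \<le> a" "a < b" "\<And>x. x \<in> {a<..<b} \<Longrightarrow> u x > v x"
  proof -
    have "((\<lambda>x. u x - v x) \<longlongrightarrow> u x0 - v x0) (at x0 within {0..})"
      using cont x0 by (intro tendsto_diff) (auto simp: continuous_on_def)
    hence "\<forall>\<^sub>F x in at x0 within {0..}. u x - v x > 0"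
      using neg by (intro order_tendstoD) auto
    then obtain d where d: "d > 0" "\<And>x. 0 \<le> x \<Longrightarrow> x \<noteq> x0 \<Longrightarrow> dist x x0 < d \<Longrightarrow> u x - v x > 0"
      unfolding eventually_at by auto
    have "u x > v x" if "x \<in> {x0<..<x0+d}" for x
      using d(2)[of x] that x0 by (auto simp: dist_real_def)
    thus ?thesis using that[of x0 "x0 + d"] d x0 by auto
  qed
  \<comment> \<open>A bump in y = exp (- x), positive exactly for x strictly between a and
    b.\<close>
  define h where "h y = max 0 ((y - exp (- b)) * (exp (- a) - y))" for y :: real
  have h_cont: "continuous_on A h" for A unfolding h_def by (intro continuous_intros)
  have h_pos: "h (exp (- x)) > 0" if "x \<in> {a<..<b}" for x
    using that by (auto simp: h_def less_max_iff_disj intro!: mult_pos_pos)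
  have h_nz: "x \<in> {a<..<b}" if "h (exp (- x)) \<noteq> 0" for x
  proof (rule ccontr)
    assume "x \<notin> {a<..<b}"
    then consider "x \<le> a" | "b \<le> x" by fastforce
    hence "(exp (- x) - exp (- b)) * (exp (- a) - exp (- x)) \<le> 0"
      using ab(2) by cases (intro mult_nonneg_nonpos mult_nonpos_nonneg; simp)+
    with that show False by (simp add: h_def)
  qed
  have h_ge: "h y \<ge> 0" for y by (simp add: h_def)
  have h_bd: "h (exp (- x)) \<le> 1" for x
  proof (cases "h (exp (- x)) = 0")
    case False
    hence x: "x \<in> {a<..<b}" by (rule h_nz)
    have e: "exp (- x) \<le> 1" "exp (- a) \<le> 1" using x ab by auto
    have "(exp (- x) - exp (- b)) * (exp (- a) - exp (- x)) \<le> 1 * 1"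
    proof (intro mult_mono)
      show "exp (- x) - exp (- b) \<le> 1" "exp (- a) - exp (- x) \<le> 1"
        using e exp_gt_zero[of "- b"] exp_gt_zero[of "- x"] by linarith+
    qed (use x in auto)
    thus ?thesis by (simp add: h_def)
  qed simp
  have meas_h: "(\<lambda>x. h (exp (- x))) \<in> borel_measurable borel"
    unfolding h_def by measurable
  have Gh_int: "integrable lborel (\<lambda>x. G x * h (exp (- x)))"
  proof (rule Bochner_Integration.integrable_bound[OF G_int])
    show "AE x in lborel. norm (G x * h (exp (- x))) \<le> norm (G x)"
      using h_ge h_bd by (auto simp: abs_mult intro!: mult_left_le)
    have "G \<in> borel_measurable lborel" using G_int by auto
    thus "(\<lambda>x. G x * h (exp (- x))) \<in> borel_measurable lborel" using meas_h by measurable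
  qed
  have G_pos: "G x > 0" if "x \<in> {a<..<b}" for x
    using ab(1) ab(3)[OF that] that by (auto simp: G_def)
  have "AE x in lborel. G x * h (exp (- x)) = 0"
  proof (rule integral_nonneg_eq_0_iff_AE[THEN iffD1])
    show "AE x in lborel. 0 \<le> G x * h (exp (- x))"
    proof (rule AE_I2)
      fix x show "0 \<le> G x * h (exp (- x))"
        by (cases "h (exp (- x)) = 0") (use h_nz[of x] G_pos[of x] h_ge[of "exp (- x)"] in auto)
    qed
  qed (use Gh_int cont0[OF h_cont Gh_int] in auto)
  hence "AE x in lborel. x \<notin> {a<..<b}"
    by (rule AE_mp) (use h_pos G_pos in \<open>auto intro!: AE_I2 simp: less_imp_neq[symmetric] simp del: greaterThanLessThan_iff\<close>)
  hence "{a<..<b} \<in> null_sets lborel"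
    by (subst AE_iff_null_sets[of "{a<..<b}" lborel, THEN iffD2]) auto
  thus False using ab(2) by (auto simp: null_sets_def)
qed

lemma laplace_moments_unique:
  fixes u v :: "real \<Rightarrow> real"
  assumes "continuous_on {0..} u" "continuous_on {0..} v"
    and "\<And>x. 0 \<le> x \<Longrightarrow> 0 \<le> u x" "\<And>x. 0 \<le> x \<Longrightarrow> 0 \<le> v x"
    and eq: "\<And>n. 2 \<le> n \<Longrightarrow> (\<integral>\<^sup>+x. ennreal (exp (- real n * x) * u x) * indicator {0..} x \<partial>lborel)
                = (\<integral>\<^sup>+x. ennreal (exp (- real n * x) * v x) * indicator {0..} x \<partial>lborel)"
    and "\<And>n. 2 \<le> n \<Longrightarrow> (\<integral>\<^sup>+x. ennreal (exp (- real n * x) * u x) * indicator {0..} x \<partial>lborel) < \<infinity>"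
    and "0 \<le> x"
  shows "u x = v x"
proof (rule antisym)
  show "u x \<le> v x" using assms by (intro laplace_le_if_moments_eq[of u v])
  show "v x \<le> u x" using assms by (intro laplace_le_if_moments_eq[of v u]) simp_all
qed

section \<open>The Mittag-Leffler series\<close>

text \<open>In the Gamma integral, keep only s \<ge> y and bound \<open>s powr t\<close> below by
  \<open>y powr t\<close>. As y is free, Gamma (1 + t) outgrows every exponential in t.\<close>

lemma Gamma_ge_powr_mult_exp:
  fixes t y :: real
  assumes "0 \<le> t" "0 < y"
  shows "y powr t * exp (- y) \<le> Gamma (1 + t)"
proof -
  have "((\<lambda>s. s powr t / exp s) has_integral Gamma (1 + t)) {0..}"
    using Gamma_integral_real[of "1 + t"] assms by simp
  moreover have "((\<lambda>s. y powr t * exp (- 1 * s)) has_integral y powr t * (exp (- 1 * y) / 1)) {y..}"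
    by (intro has_integral_mult_right has_integral_exp_minus_to_infinity) simp
  hence "((\<lambda>s. if s \<in> {y..} then y powr t * exp (- 1 * s) else 0) has_integral
      y powr t * (exp (- 1 * y) / 1)) {0..}"
    using assms by (subst has_integral_restrict) auto
  ultimately have "y powr t * (exp (- 1 * y) / 1) \<le> Gamma (1 + t)"
    using assms
    by (elim has_integral_le[rotated]) (auto simp: exp_minus divide_inverse intro!: mult_right_mono powr_mono2)
  thus ?thesis by simp
qed

lemma summable_mittag_leffler_nonneg:
  fixes \<alpha> z :: real
  assumes "0 < \<alpha>" "0 \<le> z"
  shows "summable (\<lambda>n. z ^ n / Gamma (1 + real n * \<alpha>))"
proof (rule summable_comparison_test')
  \<comment> \<open>Chosen so that \<open>y powr (n * \<alpha>)\<close> is (2 z + 1)^n, which beats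
    z^n by the factor 2^n; the summand 1 keeps y positive at z = 0.\<close>
  define y where "y = (2 * z + 1) powr (1 / \<alpha>)"
  have y: "y > 0" using assms by (simp add: y_def)
  show "summable (\<lambda>n. exp y * (1 / 2) ^ n :: real)" by (intro summable_mult summable_geometric) simp
  fix n :: nat
  have "(2 * z + 1) ^ n * exp (- y) \<le> Gamma (1 + real n * \<alpha>)"
  proof -
    have "y powr (real n * \<alpha>) = (2 * z + 1) ^ n"
      using assms by (simp add: y_def powr_powr powr_realpow)
    thus ?thesis using Gamma_ge_powr_mult_exp[of "real n * \<alpha>" y] y assms by simp
  qed
  moreover have "Gamma (1 + real n * \<alpha>) > 0" using assms by (intro Gamma_real_pos) (auto intro: add_pos_nonneg)
  moreover have "z ^ n \<le> (1 / 2) ^ n * (2 * z + 1) ^ n"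
    unfolding power_mult_distrib [symmetric] using assms by (intro power_mono) auto
  moreover have "exp y * (1 / 2) ^ n * ((2 * z + 1) ^ n * exp (- y)) = (1 / 2) ^ n * (2 * z + 1) ^ n"
    by (simp add: exp_minus)
  ultimately have "Gamma (1 + real n * \<alpha>) > 0" "(2 * z + 1) ^ n * exp (- y) \<le> Gamma (1 + real n * \<alpha>)"
    "z ^ n \<le> exp y * (1 / 2) ^ n * ((2 * z + 1) ^ n * exp (- y))" by (simp_all only:)
  hence "z ^ n \<le> exp y * (1 / 2) ^ n * Gamma (1 + real n * \<alpha>)"
    by (elim order_trans) (intro mult_left_mono, auto)
  thus "norm (z ^ n / Gamma (1 + real n * \<alpha>)) \<le> exp y * (1 / 2) ^ n"
    using assms \<open>Gamma (1 + real n * \<alpha>) > 0\<close> by (simp add: field_simps)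
qed

lemma Gamma_one_plus_pos: "0 < \<alpha> \<Longrightarrow> 0 < Gamma (1 + real n * \<alpha>)" for \<alpha> :: real
  by (intro Gamma_real_pos) (auto intro: add_pos_nonneg)

lemma continuous_mittag_leffler:
  assumes "0 < \<alpha>"
  shows "continuous_on A (mittag_leffler \<alpha>)"
proof -
  let ?c = "\<lambda>n. 1 / Gamma (1 + real n * \<alpha>)"
  have "summable (\<lambda>n. ?c n * z ^ n)" for z
  proof (rule summable_norm_cancel)
    show "summable (\<lambda>n. norm (?c n * z ^ n))"
      using summable_mittag_leffler_nonneg[OF assms, of "\<bar>z\<bar>"] Gamma_one_plus_pos[OF assms]
      by (simp add: abs_mult power_abs less_imp_le)
  qed
  hence "isCont (\<lambda>z. \<Sum>n. ?c n * z ^ n) z" for z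
    by (rule isCont_powser_converges_everywhere)
  thus ?thesis unfolding mittag_leffler_def[abs_def]
    by (intro continuous_at_imp_continuous_on) simp
qed

lemma mittag_leffler_nonneg:
  assumes "0 < \<alpha>" "0 \<le> z"
  shows "0 \<le> mittag_leffler \<alpha> z"
  unfolding mittag_leffler_def
  using assms Gamma_one_plus_pos[OF assms(1)] summable_mittag_leffler_nonneg[OF assms]
  by (intro suminf_nonneg) (auto simp: less_imp_le)

lemma mittag_leffler_0: "mittag_leffler \<alpha> 0 = 1"
  unfolding mittag_leffler_def using suminf_finite[of "{0}" "\<lambda>n. 0 ^ n / Gamma (1 + real n * \<alpha>)"]
  by simp

section \<open>Laplace transforms of powers and of the Mittag-Leffler function\<close>

lemma nn_integral_powr_exp:
  fixes t lam :: real
  assumes "0 \<le> t" "0 < lam"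
  shows "(\<integral>\<^sup>+x. ennreal (exp (- lam * x) * x powr t) * indicator {0..} x \<partial>lborel)
     = ennreal (Gamma (1 + t) / lam powr (1 + t))"
proof -
  have "ennreal (Gamma (1 + t)) = (\<integral>\<^sup>+x. ennreal (indicator {0..} x * x powr t / exp x) \<partial>lborel)"
    using Gamma_conv_nn_integral_real[of "1 + t"] assms by simp
  also have "\<dots> = ennreal \<bar>lam\<bar> * (\<integral>\<^sup>+x. ennreal (indicator {0..} (0 + lam * x) * (0 + lam * x) powr t / exp (0 + lam * x)) \<partial>lborel)"
    using assms by (intro nn_integral_real_affine) auto
  also have "\<dots> = ennreal lam * (\<integral>\<^sup>+x. ennreal (lam powr t) * (ennreal (exp (- lam * x) * x powr t) * indicator {0..} x) \<partial>lborel)"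
    using assms by (intro arg_cong2[of _ _ _ _ "(*)"] nn_integral_cong)
      (auto simp: indicator_def powr_mult exp_minus zero_le_mult_iff field_simps simp flip: ennreal_mult)
  also have "\<dots> = ennreal lam * (ennreal (lam powr t) * (\<integral>\<^sup>+x. ennreal (exp (- lam * x) * x powr t) * indicator {0..} x \<partial>lborel))"
    by (subst nn_integral_cmult) auto
  also have "\<dots> = ennreal (lam powr (1 + t)) * (\<integral>\<^sup>+x. ennreal (exp (- lam * x) * x powr t) * indicator {0..} x \<partial>lborel)"
    using assms by (simp add: powr_add mult.assoc [symmetric] flip: ennreal_mult)
  finally have eq: "ennreal (Gamma (1 + t)) = ennreal (lam powr (1 + t)) * (\<integral>\<^sup>+x. ennreal (exp (- lam * x) * x powr t) * indicator {0..} x \<partial>lborel)" (is "_ = _ * ?I") .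
  have "ennreal (Gamma (1 + t) / lam powr (1 + t)) = ennreal (1 / lam powr (1 + t)) * ennreal (Gamma (1 + t))"
    using assms by (simp flip: ennreal_mult add: Gamma_real_nonneg)
  also have "\<dots> = ennreal (1 / lam powr (1 + t)) * ennreal (lam powr (1 + t)) * ?I"
    unfolding eq by (simp add: mult.assoc)
  also have "ennreal (1 / lam powr (1 + t)) * ennreal (lam powr (1 + t)) = 1"
    using assms by (simp flip: ennreal_mult)
  finally show ?thesis by simp
qed

text \<open>All terms are nonnegative, so the series is integrated term by term. The Gamma factors
  cancel and a geometric series with ratio \<open>lam powr - \<alpha>\<close> remains, convergent as
  \<open>lam\<close> exceeds 1.\<close>

lemma nn_integral_mittag_leffler:
  fixes \<alpha> lam :: real
  assumes "0 < \<alpha>" "1 < lam"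
  shows "(\<integral>\<^sup>+x. ennreal (exp (- lam * x) * mittag_leffler \<alpha> (x powr \<alpha>)) * indicator {0..} x \<partial>lborel)
     = ennreal (1 / (lam * (1 - lam powr - \<alpha>)))"
proof -
  define T where "T n x = exp (- lam * x) * ((x powr \<alpha>) ^ n / Gamma (1 + real n * \<alpha>))" for n x
  have T_nonneg: "0 \<le> T n x" if "0 \<le> x" for n x
    using Gamma_one_plus_pos[OF assms(1), of n] that by (simp add: T_def)
  have T_sum: "(\<lambda>n. T n x) sums (exp (- lam * x) * mittag_leffler \<alpha> (x powr \<alpha>))" for x
    unfolding T_def mittag_leffler_def
    by (intro sums_mult summable_sums summable_mittag_leffler_nonneg assms) simp
  have "(\<integral>\<^sup>+x. ennreal (exp (- lam * x) * mittag_leffler \<alpha> (x powr \<alpha>)) * indicator {0..} x \<partial>lborel)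
    = (\<integral>\<^sup>+x. (\<Sum>n. ennreal (T n x) * indicator {0..} x) \<partial>lborel)"
  proof (intro nn_integral_cong)
    fix x :: real
    show "ennreal (exp (- lam * x) * mittag_leffler \<alpha> (x powr \<alpha>)) * indicator {0..} x
       = (\<Sum>n. ennreal (T n x) * indicator {0..} x)"
    proof (cases "0 \<le> x")
      case True
      thus ?thesis using T_sum[of x] T_nonneg[OF True]
        by (simp add: suminf_ennreal2 sums_iff)
    qed simp
  qed
  also have "\<dots> = (\<Sum>n. \<integral>\<^sup>+x. ennreal (T n x) * indicator {0..} x \<partial>lborel)"
    unfolding T_def by (intro nn_integral_suminf) measurable
  also have "\<dots> = (\<Sum>n. ennreal ((lam powr - \<alpha>) ^ n / lam))"
  proof (intro suminf_cong)
    fix n :: nat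
    have "(\<integral>\<^sup>+x. ennreal (T n x) * indicator {0..} x \<partial>lborel)
       = (\<integral>\<^sup>+x. ennreal (1 / Gamma (1 + real n * \<alpha>)) *
              (ennreal (exp (- lam * x) * x powr (real n * \<alpha>)) * indicator {0..} x) \<partial>lborel)"
    proof (intro nn_integral_cong_AE)
      \<comment> \<open>The point 0 is excluded because of n = 0: there the zeroth power is 1,
        whereas \<open>0 powr 0\<close> is 0.\<close>
      have "AE x in lborel. x \<noteq> (0 :: real)" by (rule AE_lborel_singleton)
      thus "AE x in lborel. ennreal (T n x) * indicator {0..} x =
         ennreal (1 / Gamma (1 + real n * \<alpha>)) *
              (ennreal (exp (- lam * x) * x powr (real n * \<alpha>)) * indicator {0..} x)"
      proof eventually_elim
        case (elim x)
        have "(x powr \<alpha>) ^ n = x powr (real n * \<alpha>)" if "0 \<le> x"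
          using that elim by (simp add: powr_powr mult.commute flip: powr_realpow)
        thus ?case using Gamma_one_plus_pos[OF assms(1), of n]
          by (auto simp: indicator_def T_def simp flip: ennreal_mult)
      qed
    qed
    also have "\<dots> = ennreal (1 / Gamma (1 + real n * \<alpha>)) * ennreal (Gamma (1 + real n * \<alpha>) / lam powr (1 + real n * \<alpha>))"
      using assms by (subst nn_integral_cmult) (simp_all add: nn_integral_powr_exp[simplified])
    also have "\<dots> = ennreal (1 / lam powr (1 + real n * \<alpha>))"
      using Gamma_one_plus_pos[OF assms(1), of n] by (simp flip: ennreal_mult)
    also have "1 / lam powr (1 + real n * \<alpha>) = (lam powr - \<alpha>) ^ n / lam"
    proof -
      have "(lam powr - \<alpha>) ^ n = lam powr (- (real n * \<alpha>))"
        using assms by (simp add: powr_powr mult.commute flip: powr_realpow)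
      thus ?thesis using assms by (simp add: powr_add powr_minus field_simps)
    qed
    finally show "(\<integral>\<^sup>+x. ennreal (T n x) * indicator {0..} x \<partial>lborel) = ennreal ((lam powr - \<alpha>) ^ n / lam)" .
  qed
  also have "\<dots> = ennreal (1 / (lam * (1 - lam powr - \<alpha>)))"
  proof -
    have "lam powr - \<alpha> < 1" using assms by (simp add: powr_less_one)
    hence "(\<lambda>n. (lam powr - \<alpha>) ^ n / lam) sums (1 / (1 - lam powr - \<alpha>) / lam)"
      by (intro sums_divide geometric_sums) simp
    thus ?thesis using assms by (simp add: suminf_ennreal2 sums_iff mult.commute)
  qed
  finally show ?thesis .
qed

section \<open>The integral representation\<close>

definition kernel_laplace :: "real \<Rightarrow> real \<Rightarrow> real" where
  "kernel_laplace \<alpha> x = (\<integral>s. exp (- x * exp s) * ml_kernel \<alpha> s \<partial>lborel)"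

section \<open>Sign and integrability of the kernel\<close>

lemma ml_kernel_measurable [measurable]: "ml_kernel \<alpha> \<in> borel_measurable borel"
proof -
  have "(\<lambda>s. cosh (\<alpha> * s)) \<in> borel_measurable borel"
    by (intro borel_measurable_continuous_onI continuous_intros)
  thus ?thesis unfolding ml_kernel_def[abs_def] by measurable
qed

lemma ml_kernel_even: "ml_kernel \<alpha> (- s) = ml_kernel \<alpha> s"
  by (simp add: ml_kernel_def)

lemma ml_kernel_nonneg:
  assumes "0 < \<alpha>" "\<alpha> \<le> 1"
  shows "0 \<le> ml_kernel \<alpha> s"
proof -
  have "0 \<le> sin (pi * \<alpha>)" using assms by (intro sin_ge_zero) auto
  thus ?thesis using ml_kernel_denom_pos[of \<alpha> s] assms by (simp add: ml_kernel_def)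
qed

lemma ml_kernel_nonpos:
  assumes "1 \<le> \<alpha>" "\<alpha> < 2"
  shows "ml_kernel \<alpha> s \<le> 0"
proof -
  have "0 \<le> sin (pi * \<alpha> - pi)" using assms by (intro sin_ge_zero) (auto simp: algebra_simps)
  hence "sin (pi * \<alpha>) \<le> 0" by (simp add: sin_diff)
  thus ?thesis using ml_kernel_denom_pos[of \<alpha> s] assms
    by (simp add: ml_kernel_def divide_nonpos_pos)
qed

text \<open>The sign \<sigma> makes the integrand nonnegative, so by monotone convergence the limit
  of the integrals over [-R, R] found by contour integration is the integral over the whole
  line.\<close>

lemma nn_integral_abs_ml_kernel:
  fixes \<alpha> lam :: real
  assumes "0 < \<alpha>" "\<alpha> < 2" "1 < lam" and \<sigma>: "\<bar>\<sigma>\<bar> = 1" "\<And>s. 0 \<le> \<sigma> * ml_kernel \<alpha> s"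
  defines "L \<equiv> \<sigma> * (1 / (\<alpha> * (lam - 1)) - 1 / (lam * (1 - lam powr - \<alpha>)))"
  shows "(\<integral>\<^sup>+s. ennreal (\<sigma> * ml_kernel \<alpha> s / (lam + exp s)) \<partial>lborel) = ennreal L" "0 \<le> L"
proof -
  interpret kernel_stieltjes \<alpha> lam using assms by unfold_locales
  define F where "F s = \<sigma> * ml_kernel \<alpha> s / (lam + exp s)" for s
  have den: "0 < lam + exp s" for s :: real using lam exp_gt_zero[of s] by linarith
  have F_nonneg: "0 \<le> F s" for s
    unfolding F_def using \<sigma>(2)[of s] den[of s] by simp
  have [measurable]: "F \<in> borel_measurable borel" unfolding F_def[abs_def] by measurable
  have cont: "continuous_on A F" for A
    unfolding F_def[abs_def] times_divide_eq_right [symmetric]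
    by (intro continuous_on_mult_left continuous_on_kernel_div)
  have "((\<lambda>R. \<sigma> * integral {-R..R} (\<lambda>s. ml_kernel \<alpha> s / (lam + exp s))) \<longlongrightarrow> L) at_top"
    unfolding assms(6) by (intro tendsto_intros integral_kernel_div_tendsto[unfolded L_def])
  hence "((\<lambda>R. integral {-R..R} F) \<longlongrightarrow> L) at_top"
    unfolding F_def times_divide_eq_right [symmetric] integral_mult_right .
  hence lim: "(\<lambda>n. integral {- real n..real n} F) \<longlonglongrightarrow> L"
    by (rule filterlim_compose) (rule filterlim_real_sequentially)
  have int_nonneg: "0 \<le> integral {- real n..real n} F" for n
    using F_nonneg by (intro integral_nonneg integrable_continuous_interval cont)
  show "0 \<le> L" using lim by (rule LIMSEQ_le_const) (use int_nonneg in auto)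
  have "(\<lambda>n. \<integral>\<^sup>+s. ennreal (F s) * indicator {- real n..real n} s \<partial>lborel) \<longlonglongrightarrow> (\<integral>\<^sup>+s. ennreal (F s) \<partial>lborel)"
  proof (rule nn_integral_LIMSEQ)
    show "incseq (\<lambda>n s. ennreal (F s) * indicator {- real n..real n} s)"
      by (auto simp: incseq_def le_fun_def indicator_def)
    fix s :: real
    obtain N :: nat where N: "\<bar>s\<bar> \<le> real N" using real_arch_simple by blast
    show "(\<lambda>n. ennreal (F s) * indicator {- real n..real n} s) \<longlonglongrightarrow> ennreal (F s)"
    proof (rule tendsto_eventually, rule eventually_sequentiallyI)
      fix n assume "N \<le> n"
      hence "\<bar>s\<bar> \<le> real n" using N by linarith
      thus "ennreal (F s) * indicator {- real n..real n} s = ennreal (F s)"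
        by (auto simp: indicator_def abs_le_iff)
    qed
  qed auto
  moreover have "(\<integral>\<^sup>+s. ennreal (F s) * indicator {- real n..real n} s \<partial>lborel) = ennreal (integral {- real n..real n} F)" for n
  proof -
    have "(F has_integral integral {- real n..real n} F) {- real n..real n}"
      by (intro integrable_integral integrable_continuous_interval cont)
    from nn_integral_has_integral_lebesgue[OF _ this] F_nonneg
    have "ennreal (integral {- real n..real n} F) = (\<integral>\<^sup>+s. ennreal (indicator {- real n..real n} s * F s) \<partial>lborel)"
      by simp
    also have "\<dots> = (\<integral>\<^sup>+s. ennreal (F s) * indicator {- real n..real n} s \<partial>lborel)"
      by (intro nn_integral_cong) (auto simp: indicator_def)
    finally show ?thesis ..
  qed
  ultimately have "(\<lambda>n. ennreal (integral {- real n..real n} F)) \<longlonglongrightarrow> (\<integral>\<^sup>+s. ennreal (F s) \<partial>lborel)"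
    by simp
  moreover have "(\<lambda>n. ennreal (integral {- real n..real n} F)) \<longlonglongrightarrow> ennreal L"
    using lim by (rule tendsto_ennrealI)
  ultimately show "(\<integral>\<^sup>+s. ennreal (\<sigma> * ml_kernel \<alpha> s / (lam + exp s)) \<partial>lborel) = ennreal L"
    unfolding F_def by (rule LIMSEQ_unique)
qed

lemma ml_kernel_sign:
  assumes "0 < \<alpha>" "\<alpha> < 2"
  obtains \<sigma> :: real where "\<sigma> = (if \<alpha> \<le> 1 then 1 else - 1)" "\<bar>\<sigma>\<bar> = 1" "\<And>s. 0 \<le> \<sigma> * ml_kernel \<alpha> s"
  using that[of "if \<alpha> \<le> 1 then 1 else - 1"] ml_kernel_nonneg[of \<alpha>] ml_kernel_nonpos[of \<alpha>] assms
  by (cases "\<alpha> \<le> 1") auto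

text \<open>The transform at \<open>lam\<close> = 2 is finite, and its weight 1 / (2 + exp s) is at
  least 1/3 for s \<le> 0. Evenness carries this over to s \<ge> 0: adding the reflected integrand
  gives a majorant up to the factor 3.\<close>

lemma integrable_ml_kernel:
  assumes "0 < \<alpha>" "\<alpha> < 2"
  shows "integrable lborel (ml_kernel \<alpha>)"
proof -
  obtain \<sigma> :: real where \<sigma>: "\<bar>\<sigma>\<bar> = 1" "\<And>s. 0 \<le> \<sigma> * ml_kernel \<alpha> s"
    using ml_kernel_sign[OF assms] by metis
  define F where "F s = \<sigma> * ml_kernel \<alpha> s / (2 + exp s)" for s
  have den: "0 < 2 + exp s" for s :: real using exp_gt_zero[of s] by linarith
  have F: "integrable lborel F"
  proof (rule integrableI_nonneg)
    show "(\<integral>\<^sup>+s. ennreal (F s) \<partial>lborel) < \<infinity>"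
      using nn_integral_abs_ml_kernel[of \<alpha> 2 \<sigma>] assms \<sigma> unfolding F_def by simp
    show "AE s in lborel. 0 \<le> F s" using \<sigma>(2) den by (auto simp: F_def less_imp_le intro!: AE_I2 divide_nonneg_pos)
    show "F \<in> borel_measurable lborel" unfolding F_def[abs_def] by measurable
  qed
  hence "integrable lborel (\<lambda>s. F (0 + (- 1) * s))"
    by (rule lborel_integrable_real_affine) simp
  hence F': "integrable lborel (\<lambda>s. 3 * (F s + F (- s)))"
    using F by (intro integrable_mult_right integrable_add) auto
  show ?thesis
  proof (rule Bochner_Integration.integrable_bound[OF F'])
    show "AE s in lborel. norm (ml_kernel \<alpha> s) \<le> norm (3 * (F s + F (- s)))"
    proof (rule AE_I2)
      fix s :: real
      have abs: "\<bar>ml_kernel \<alpha> s\<bar> = \<sigma> * ml_kernel \<alpha> s"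
        using \<sigma>(1) \<sigma>(2)[of s] by (metis abs_mult abs_of_nonneg mult_1)
      have "1 / 3 \<le> 1 / (2 + exp s) + 1 / (2 + exp (- s))"
      proof -
        have "1 / 3 \<le> 1 / (2 + exp (- \<bar>s\<bar>))"
          by (intro divide_left_mono) (auto intro!: mult_pos_pos add_pos_pos)
        moreover have "0 \<le> 1 / (2 + exp s)" "0 \<le> 1 / (2 + exp (- s))"
          using den[of s] den[of "- s"] by simp_all
        moreover have "1 / (2 + exp (- \<bar>s\<bar>)) = 1 / (2 + exp s) \<or> 1 / (2 + exp (- \<bar>s\<bar>)) = 1 / (2 + exp (- s))"
          by (cases "0 \<le> s") auto
        ultimately show ?thesis by linarith
      qed
      hence "\<bar>ml_kernel \<alpha> s\<bar> * (1 / 3) \<le> \<bar>ml_kernel \<alpha> s\<bar> * (1 / (2 + exp s) + 1 / (2 + exp (- s)))"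
        by (intro mult_left_mono) auto
      also have "\<dots> = F s + F (- s)"
        unfolding abs F_def ml_kernel_even by (simp add: ring_distribs)
      finally show "norm (ml_kernel \<alpha> s) \<le> norm (3 * (F s + F (- s)))"
        by simp
    qed
  qed auto
qed

lemma integrable_exp_ml_kernel:
  assumes "0 < \<alpha>" "\<alpha> < 2" "0 \<le> x"
  shows "integrable lborel (\<lambda>s. exp (- x * exp s) * ml_kernel \<alpha> s)"
  by (rule Bochner_Integration.integrable_bound[OF integrable_ml_kernel[OF assms(1,2)]])
     (use assms in \<open>auto simp: abs_mult intro!: mult_left_le_one_le\<close>)

lemma continuous_kernel_laplace:
  assumes "0 < \<alpha>" "\<alpha> < 2"
  shows "continuous_on {0..} (kernel_laplace \<alpha>)"
  unfolding continuous_on_sequentially o_def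
proof (intro allI ballI impI, elim conjE)
  fix X :: "nat \<Rightarrow> real" and a :: real
  assume X: "\<forall>n. X n \<in> {0..}" "X \<longlonglongrightarrow> a"
  show "(\<lambda>n. kernel_laplace \<alpha> (X n)) \<longlonglongrightarrow> kernel_laplace \<alpha> a"
    unfolding kernel_laplace_def
  proof (rule integral_dominated_convergence[where w = "\<lambda>s. \<bar>ml_kernel \<alpha> s\<bar>"])
    show "integrable lborel (\<lambda>s. \<bar>ml_kernel \<alpha> s\<bar>)"
      using integrable_ml_kernel[OF assms] by simp
    show "AE s in lborel. (\<lambda>n. exp (- X n * exp s) * ml_kernel \<alpha> s) \<longlonglongrightarrow> exp (- a * exp s) * ml_kernel \<alpha> s"
      by (intro AE_I2 tendsto_intros X)
    show "AE s in lborel. norm (exp (- X n * exp s) * ml_kernel \<alpha> s) \<le> \<bar>ml_kernel \<alpha> s\<bar>" for n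
      using X(1) by (intro AE_I2) (auto simp: abs_mult intro!: mult_left_le_one_le)
  qed measurable
qed

section \<open>Laplace transforms of the remaining terms of the representation\<close>

lemma nn_integral_exp_atLeast_0:
  fixes c :: real
  assumes "0 < c"
  shows "(\<integral>\<^sup>+x. ennreal (exp (- c * x)) * indicator {0..} x \<partial>lborel) = ennreal (1 / c)"
proof -
  have "(\<integral>\<^sup>+x. ennreal (exp (- c * x)) * indicator {0..} x \<partial>lborel)
     = (\<integral>\<^sup>+x. ennreal (exp (- c * x) * x powr 0) * indicator {0..} x \<partial>lborel)"
    using AE_lborel_singleton[of 0] by (intro nn_integral_cong_AE) (auto elim!: eventually_mono)
  thus ?thesis using nn_integral_powr_exp[of 0 c] assms by simp
qed

text \<open>By Tonelli the integral over x can be done first; it gives 1 / (lam + exp s), so the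
  Laplace transform of \<open>kernel_laplace\<close> is the Stieltjes transform of the
  kernel.\<close>

lemma nn_integral_kernel_laplace:
  fixes \<alpha> lam \<sigma> :: real
  assumes \<alpha>: "0 < \<alpha>" "\<alpha> < 2" and lam: "1 < lam" and \<sigma>: "\<bar>\<sigma>\<bar> = 1" "\<And>s. 0 \<le> \<sigma> * ml_kernel \<alpha> s"
  shows "(\<integral>\<^sup>+x. ennreal (exp (- lam * x) * (\<sigma> * kernel_laplace \<alpha> x)) * indicator {0..} x \<partial>lborel)
     = ennreal (\<sigma> * (1 / (\<alpha> * (lam - 1)) - 1 / (lam * (1 - lam powr - \<alpha>))))"
proof -
  have den: "0 < lam + exp s" for s :: real using lam exp_gt_zero[of s] by linarith
  have "(\<integral>\<^sup>+x. ennreal (exp (- lam * x) * (\<sigma> * kernel_laplace \<alpha> x)) * indicator {0..} x \<partial>lborel)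
    = (\<integral>\<^sup>+x. \<integral>\<^sup>+s. ennreal (\<sigma> * ml_kernel \<alpha> s) * (ennreal (exp (- (lam + exp s) * x)) * indicator {0..} x) \<partial>lborel \<partial>lborel)"
  proof (intro nn_integral_cong)
    fix x :: real
    show "ennreal (exp (- lam * x) * (\<sigma> * kernel_laplace \<alpha> x)) * indicator {0..} x =
       (\<integral>\<^sup>+s. ennreal (\<sigma> * ml_kernel \<alpha> s) * (ennreal (exp (- (lam + exp s) * x)) * indicator {0..} x) \<partial>lborel)"
    proof (cases "0 \<le> x")
      case True
      have e: "exp (- lam * x) * (\<sigma> * (exp (- x * exp s) * ml_kernel \<alpha> s)) =
          \<sigma> * ml_kernel \<alpha> s * exp (- (lam + exp s) * x)" for s
      proof -
        have "exp (- (lam + exp s) * x) = exp (- lam * x) * exp (- x * exp s)"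
          by (simp add: exp_add [symmetric] algebra_simps)
        thus ?thesis by simp
      qed
      have "exp (- lam * x) * (\<sigma> * kernel_laplace \<alpha> x) =
          (\<integral>s. exp (- lam * x) * (\<sigma> * (exp (- x * exp s) * ml_kernel \<alpha> s)) \<partial>lborel)"
        unfolding kernel_laplace_def by simp
      also have "\<dots> = (\<integral>s. \<sigma> * ml_kernel \<alpha> s * exp (- (lam + exp s) * x) \<partial>lborel)"
        by (simp only: e)
      also have "ennreal \<dots> = (\<integral>\<^sup>+s. ennreal (\<sigma> * ml_kernel \<alpha> s * exp (- (lam + exp s) * x)) \<partial>lborel)"
      proof (rule nn_integral_eq_integral [symmetric])
        show "integrable lborel (\<lambda>s. \<sigma> * ml_kernel \<alpha> s * exp (- (lam + exp s) * x))"
          unfolding e [symmetric] using integrable_exp_ml_kernel[OF \<alpha> True] by simp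
      qed (use \<sigma>(2) in auto)
      finally show ?thesis using True \<sigma>(2) by (simp add: ennreal_mult')
    qed simp
  qed
  also have "\<dots> = (\<integral>\<^sup>+s. \<integral>\<^sup>+x. ennreal (\<sigma> * ml_kernel \<alpha> s) * (ennreal (exp (- (lam + exp s) * x)) * indicator {0..} x) \<partial>lborel \<partial>lborel)"
    by (rule lborel_pair.Fubini') measurable
  also have "\<dots> = (\<integral>\<^sup>+s. ennreal (\<sigma> * ml_kernel \<alpha> s / (lam + exp s)) \<partial>lborel)"
  proof (intro nn_integral_cong)
    fix s :: real
    have "(\<integral>\<^sup>+x. ennreal (\<sigma> * ml_kernel \<alpha> s) * (ennreal (exp (- (lam + exp s) * x)) * indicator {0..} x) \<partial>lborel)
       = ennreal (\<sigma> * ml_kernel \<alpha> s) * ennreal (1 / (lam + exp s))"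
      using den[of s] by (subst nn_integral_cmult) (simp_all only: nn_integral_exp_atLeast_0, measurable)
    also have "\<dots> = ennreal (\<sigma> * ml_kernel \<alpha> s / (lam + exp s))"
      using den[of s] \<sigma>(2)[of s] by (simp flip: ennreal_mult)
    finally show "(\<integral>\<^sup>+x. ennreal (\<sigma> * ml_kernel \<alpha> s) * (ennreal (exp (- (lam + exp s) * x)) * indicator {0..} x) \<partial>lborel)
       = ennreal (\<sigma> * ml_kernel \<alpha> s / (lam + exp s))" .
  qed
  also have "\<dots> = ennreal (\<sigma> * (1 / (\<alpha> * (lam - 1)) - 1 / (lam * (1 - lam powr - \<alpha>))))"
    by (rule nn_integral_abs_ml_kernel[OF \<alpha> lam \<sigma>])
  finally show ?thesis .
qed

lemma nn_integral_exp_over: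
  fixes \<alpha> lam :: real
  assumes "0 < \<alpha>" "1 < lam"
  shows "(\<integral>\<^sup>+x. ennreal (exp (- lam * x) * (exp x / \<alpha>)) * indicator {0..} x \<partial>lborel) = ennreal (1 / (\<alpha> * (lam - 1)))"
proof -
  have "(\<integral>\<^sup>+x. ennreal (exp (- lam * x) * (exp x / \<alpha>)) * indicator {0..} x \<partial>lborel)
    = (\<integral>\<^sup>+x. ennreal (1 / \<alpha>) * (ennreal (exp (- (lam - 1) * x)) * indicator {0..} x) \<partial>lborel)"
  proof (intro nn_integral_cong)
    fix x :: real
    have "exp (- lam * x) * exp x = exp (- (lam - 1) * x)" by (simp add: exp_add [symmetric] algebra_simps)
    thus "ennreal (exp (- lam * x) * (exp x / \<alpha>)) * indicator {0..} x =
       ennreal (1 / \<alpha>) * (ennreal (exp (- (lam - 1) * x)) * indicator {0..} x)"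
      using assms by (auto simp: indicator_def simp flip: ennreal_mult)
  qed
  also have "\<dots> = ennreal (1 / \<alpha>) * ennreal (1 / (lam - 1))"
    using assms by (subst nn_integral_cmult) (simp_all only: nn_integral_exp_atLeast_0, auto)
  also have "\<dots> = ennreal (1 / (\<alpha> * (lam - 1)))" using assms by (simp flip: ennreal_mult)
  finally show ?thesis .
qed

lemma nn_integral_laplace_add:
  fixes u v :: "real \<Rightarrow> real"
  assumes "continuous_on {0..} u" "continuous_on {0..} v"
    and "\<And>x. 0 \<le> x \<Longrightarrow> 0 \<le> u x" "\<And>x. 0 \<le> x \<Longrightarrow> 0 \<le> v x"
  shows "(\<integral>\<^sup>+x. ennreal (exp (- lam * x) * (u x + v x)) * indicator {0..} x \<partial>lborel) =
    (\<integral>\<^sup>+x. ennreal (exp (- lam * x) * u x) * indicator {0..} x \<partial>lborel) +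
    (\<integral>\<^sup>+x. ennreal (exp (- lam * x) * v x) * indicator {0..} x \<partial>lborel)"
proof -
  have meas: "(\<lambda>x. ennreal (exp (- lam * x) * w x) * indicator {0..} x) \<in> borel_measurable lborel"
    if "continuous_on {0..} w" for w :: "real \<Rightarrow> real"
  proof -
    have "(\<lambda>x. indicator {0..} x *\<^sub>R (exp (- lam * x) * w x)) \<in> borel_measurable borel"
      using that by (intro borel_measurable_continuous_on_indicator continuous_intros) auto
    hence "(\<lambda>x. ennreal (indicator {0..} x *\<^sub>R (exp (- lam * x) * w x))) \<in> borel_measurable lborel" by measurable
    also have "(\<lambda>x. ennreal (indicator {0..} x *\<^sub>R (exp (- lam * x) * w x))) =
        (\<lambda>x. ennreal (exp (- lam * x) * w x) * indicator {0..} x)"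
      by (auto simp: indicator_def)
    finally show ?thesis .
  qed
  have "(\<integral>\<^sup>+x. ennreal (exp (- lam * x) * (u x + v x)) * indicator {0..} x \<partial>lborel) =
    (\<integral>\<^sup>+x. ennreal (exp (- lam * x) * u x) * indicator {0..} x + ennreal (exp (- lam * x) * v x) * indicator {0..} x \<partial>lborel)"
    using assms(3,4) by (intro nn_integral_cong) (auto simp: indicator_def ring_distribs ennreal_plus)
  thus ?thesis by (simp only: nn_integral_add[OF meas[OF assms(1)] meas[OF assms(2)]])
qed

lemma continuous_mittag_leffler_powr:
  assumes "0 < \<alpha>"
  shows "continuous_on {0..} (\<lambda>x. mittag_leffler \<alpha> (x powr \<alpha>))"
proof (rule continuous_on_compose2[OF continuous_mittag_leffler[OF assms, of UNIV]])
  show "continuous_on {0..} (\<lambda>x :: real. x powr \<alpha>)"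
    using assms by (intro continuous_on_powr' continuous_on_id continuous_on_const) auto
qed simp

text \<open>Both sides have equal Laplace transforms at every integer n \<ge> 2. Since the
  uniqueness lemma compares nonnegative functions, the kernel integral is moved to the side where it
  counts positively; which side depends on whether \<alpha> \<le> 1.\<close>

lemma mittag_leffler_representation:
  assumes \<alpha>: "0 < \<alpha>" "\<alpha> < 2" and x: "0 \<le> x"
  shows "mittag_leffler \<alpha> (x powr \<alpha>) = exp x / \<alpha> - kernel_laplace \<alpha> x"
proof -
  obtain \<sigma> :: real where \<sigma>0: "\<sigma> = (if \<alpha> \<le> 1 then 1 else - 1)" and \<sigma>: "\<bar>\<sigma>\<bar> = 1" "\<And>s. 0 \<le> \<sigma> * ml_kernel \<alpha> s"
    using ml_kernel_sign[OF \<alpha>] by metis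
  let ?M = "\<lambda>x. mittag_leffler \<alpha> (x powr \<alpha>)" and ?E = "\<lambda>x. exp x / \<alpha>" and ?K = "\<lambda>x. \<sigma> * kernel_laplace \<alpha> x"
  have K: "0 \<le> ?K x" if "0 \<le> x" for x
  proof -
    have "0 \<le> (\<integral>s. exp (- x * exp s) * (\<sigma> * ml_kernel \<alpha> s) \<partial>lborel)"
      using \<sigma>(2) by (intro Bochner_Integration.integral_nonneg) auto
    thus ?thesis unfolding kernel_laplace_def
      by (simp add: mult.left_commute flip: Bochner_Integration.integral_mult_right_zero)
  qed
  have M: "0 \<le> ?M x" for x using \<alpha> by (intro mittag_leffler_nonneg) auto
  have E: "0 \<le> ?E x" for x using \<alpha> by simp
  have cont: "continuous_on {0..} ?M" "continuous_on {0..} ?E" "continuous_on {0..} ?K"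
    using \<alpha> continuous_kernel_laplace[OF \<alpha>] continuous_mittag_leffler_powr[OF \<alpha>(1)]
    by (auto intro!: continuous_intros)
  define A B where "A n = 1 / (real n * (1 - real n powr - \<alpha>))" and "B n = 1 / (\<alpha> * (real n - 1))" for n :: nat
  have A: "0 \<le> A n" and B: "0 \<le> B n" if "2 \<le> n" for n
  proof -
    have "real n powr - \<alpha> < 1" using that \<alpha> by (intro powr_less_one) auto
    thus "0 \<le> A n" "0 \<le> B n" using that \<alpha> by (simp_all add: A_def B_def)
  qed
  have LM: "(\<integral>\<^sup>+x. ennreal (exp (- real n * x) * ?M x) * indicator {0..} x \<partial>lborel) = ennreal (A n)"
   and LE: "(\<integral>\<^sup>+x. ennreal (exp (- real n * x) * ?E x) * indicator {0..} x \<partial>lborel) = ennreal (B n)"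
   and LK: "(\<integral>\<^sup>+x. ennreal (exp (- real n * x) * ?K x) * indicator {0..} x \<partial>lborel) = ennreal (\<sigma> * (B n - A n))"
   and LKn: "0 \<le> \<sigma> * (B n - A n)"
    if "2 \<le> n" for n
  proof -
    have n: "1 < real n" using that by simp
    show "(\<integral>\<^sup>+x. ennreal (exp (- real n * x) * ?M x) * indicator {0..} x \<partial>lborel) = ennreal (A n)"
      unfolding A_def by (rule nn_integral_mittag_leffler[OF \<alpha>(1) n])
    show "(\<integral>\<^sup>+x. ennreal (exp (- real n * x) * ?E x) * indicator {0..} x \<partial>lborel) = ennreal (B n)"
      unfolding B_def by (rule nn_integral_exp_over[OF \<alpha>(1) n])
    show "(\<integral>\<^sup>+x. ennreal (exp (- real n * x) * ?K x) * indicator {0..} x \<partial>lborel) = ennreal (\<sigma> * (B n - A n))"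
      unfolding A_def B_def by (rule nn_integral_kernel_laplace[OF \<alpha> n \<sigma>])
    show "0 \<le> \<sigma> * (B n - A n)"
      unfolding A_def B_def by (rule nn_integral_abs_ml_kernel(2)[OF \<alpha> n \<sigma>])
  qed
  show ?thesis
  proof (cases "\<alpha> \<le> 1")
    case True
    hence [simp]: "\<sigma> = 1" by (simp add: \<sigma>0)
    have "?M x + ?K x = ?E x"
    proof (rule laplace_moments_unique[where u = "\<lambda>x. ?M x + ?K x" and v = ?E])
      fix n :: nat assume n: "2 \<le> n"
      have eq: "(\<integral>\<^sup>+x. ennreal (exp (- real n * x) * (?M x + ?K x)) * indicator {0..} x \<partial>lborel) = ennreal (B n)"
        (is "?I = _")
      proof -
        have "?I = ennreal (A n) + ennreal (\<sigma> * (B n - A n))"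
          unfolding LM[OF n, symmetric] LK[OF n, symmetric]
          by (rule nn_integral_laplace_add[OF cont(1,3)]) (use M K in auto)
        thus ?thesis using LKn[OF n] A[OF n] by (simp flip: ennreal_plus)
      qed
      show "(\<integral>\<^sup>+x. ennreal (exp (- real n * x) * (?M x + ?K x)) * indicator {0..} x \<partial>lborel) =
        (\<integral>\<^sup>+x. ennreal (exp (- real n * x) * ?E x) * indicator {0..} x \<partial>lborel)"
        unfolding eq LE[OF n] ..
      show "(\<integral>\<^sup>+x. ennreal (exp (- real n * x) * (?M x + ?K x)) * indicator {0..} x \<partial>lborel) < \<infinity>"
        unfolding eq by simp
    qed (rule continuous_on_add add_nonneg_nonneg cont M K E x | assumption)+
    thus ?thesis by simp
  next
    case False
    hence [simp]: "\<sigma> = - 1" by (simp add: \<sigma>0)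
    have "?E x + ?K x = ?M x"
    proof (rule laplace_moments_unique[where u = "\<lambda>x. ?E x + ?K x" and v = ?M])
      fix n :: nat assume n: "2 \<le> n"
      have eq: "(\<integral>\<^sup>+x. ennreal (exp (- real n * x) * (?E x + ?K x)) * indicator {0..} x \<partial>lborel) = ennreal (A n)"
        (is "?I = _")
      proof -
        have "?I = ennreal (B n) + ennreal (\<sigma> * (B n - A n))"
          unfolding LE[OF n, symmetric] LK[OF n, symmetric]
          by (rule nn_integral_laplace_add[OF cont(2,3)]) (use E K in auto)
        thus ?thesis using LKn[OF n] B[OF n] by (simp flip: ennreal_plus)
      qed
      show "(\<integral>\<^sup>+x. ennreal (exp (- real n * x) * (?E x + ?K x)) * indicator {0..} x \<partial>lborel) =
        (\<integral>\<^sup>+x. ennreal (exp (- real n * x) * ?M x) * indicator {0..} x \<partial>lborel)"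
        unfolding eq LM[OF n] ..
      show "(\<integral>\<^sup>+x. ennreal (exp (- real n * x) * (?E x + ?K x)) * indicator {0..} x \<partial>lborel) < \<infinity>"
        unfolding eq by simp
    qed (rule continuous_on_add add_nonneg_nonneg cont M K E x | assumption)+
    thus ?thesis by simp
  qed
qed

section \<open>Comparison of kernels\<close>

lemma convex_on_le_chord:
  fixes f :: "real \<Rightarrow> real"
  assumes "convex_on I f" "y1 \<in> I" "y2 \<in> I" "y1 < y2" "{y1..y2} \<subseteq> I" "y \<in> {y1..y2}"
  shows "f y \<le> f y1 + (f y2 - f y1) / (y2 - y1) * (y - y1)"
  using convex_onD_Icc'[OF convex_on_subset[OF assms(1,5)] assms(6)] assms(4)
  by (simp add: add.commute)

text \<open>Slopes of a convex function increase, so a chord prolonged beyond its endpoints runs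
  below the graph.\<close>

lemma convex_on_ge_chord:
  fixes f :: "real \<Rightarrow> real"
  assumes f: "convex_on I f" and I: "y1 \<in> I" "y2 \<in> I" "y \<in> I" and "y1 < y2" "y \<le> y1 \<or> y2 \<le> y"
  shows "f y1 + (f y2 - f y1) / (y2 - y1) * (y - y1) \<le> f y"
proof -
  let ?m = "(f y2 - f y1) / (y2 - y1)"
  consider "y = y1" | "y = y2" | "y < y1" | "y2 < y" using assms by linarith
  thus ?thesis
  proof cases
    case 3
    have "(f y - f y1) / (y - y1) \<le> (f y - f y2) / (y - y2)"
      by (rule convex_on_slope_le(1)[OF f I(3,2)], use 3 assms in simp_all)
    moreover have "(f y - f y2) / (y - y2) \<le> (f y1 - f y2) / (y1 - y2)"
      by (rule convex_on_slope_le(2)[OF f I(3,2)], use 3 assms in simp_all)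
    moreover have "(f y1 - f y2) / (y1 - y2) = ?m" by (metis minus_diff_eq minus_divide_divide)
    ultimately have "(f y - f y1) / (y - y1) \<le> ?m" by linarith
    thus ?thesis using 3 by (simp add: neg_divide_le_eq)
  next
    case 4
    have "(f y1 - f y2) / (y1 - y2) \<le> (f y1 - f y) / (y1 - y)"
      by (rule convex_on_slope_le(1)[OF f I(1,3)], use 4 assms in simp_all)
    moreover have "(f y1 - f y2) / (y1 - y2) = ?m" "(f y1 - f y) / (y1 - y) = (f y - f y1) / (y - y1)"
      by (metis minus_diff_eq minus_divide_divide)+
    ultimately have "?m \<le> (f y - f y1) / (y - y1)" by linarith
    thus ?thesis using 4 assms by (simp add: pos_le_divide_eq)
  qed (use assms in auto)
qed

section \<open>Inequalities for sinh, cosh and sin\<close>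

lemma sinh_mult_ge:
  fixes c t :: real
  assumes "1 \<le> c" "0 \<le> t"
  shows "c * sinh t \<le> sinh (c * t)"
proof -
  have "sinh (c * 0) - c * sinh 0 \<le> sinh (c * t) - c * sinh t"
  proof (rule DERIV_nonneg_imp_nondecreasing[OF assms(2)])
    fix x :: real assume x: "0 \<le> x" "x \<le> t"
    have "((\<lambda>x. sinh (c * x) - c * sinh x) has_real_derivative c * (cosh (c * x) - cosh x)) (at x)"
      by (auto intro!: derivative_eq_intros simp: algebra_simps)
    moreover have "x \<le> c * x" using mult_right_mono[OF assms(1) x(1)] by simp
    hence "0 \<le> c * (cosh (c * x) - cosh x)"
      using x assms by (intro mult_nonneg_nonneg) (simp_all add: cosh_real_nonneg_le_iff)
    ultimately show "\<exists>y. ((\<lambda>x. sinh (c * x) - c * sinh x) has_real_derivative y) (at x) \<and> 0 \<le> y" by blast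
  qed
  thus ?thesis by simp
qed

text \<open>A division-free form of the fact that sinh (c x) / sinh x increases for x > 0. The
  numerator \<open>g\<close> of its derivative vanishes at 0 and has derivative (c^2 - 1) sinh (c x)
  sinh x \<ge> 0.\<close>

lemma sinh_mult_cross_le:
  fixes c u v :: real
  assumes c: "1 \<le> c" and uv: "0 < u" "u \<le> v"
  shows "sinh (c * u) * sinh v \<le> sinh (c * v) * sinh u"
proof -
  define g where "g x = c * cosh (c * x) * sinh x - sinh (c * x) * cosh x" for x
  have g: "0 \<le> g x" if "0 \<le> x" for x
  proof -
    have "g 0 \<le> g x"
    proof (rule DERIV_nonneg_imp_nondecreasing[OF that])
      fix y :: real assume y: "0 \<le> y" "y \<le> x"
      have "(g has_real_derivative (c\<^sup>2 - 1) * (sinh (c * y) * sinh y)) (at y)"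
        unfolding g_def by (auto intro!: derivative_eq_intros simp: algebra_simps power2_eq_square)
      moreover have "0 \<le> (c\<^sup>2 - 1) * (sinh (c * y) * sinh y)"
        using c y by (intro mult_nonneg_nonneg) (auto simp: one_le_power)
      ultimately show "\<exists>d. (g has_real_derivative d) (at y) \<and> 0 \<le> d" by blast
    qed
    thus ?thesis by (simp add: g_def)
  qed
  have "sinh (c * u) / sinh u \<le> sinh (c * v) / sinh v"
  proof (rule DERIV_nonneg_imp_nondecreasing[OF uv(2)])
    fix x :: real assume x: "u \<le> x" "x \<le> v"
    have "((\<lambda>x. sinh (c * x) / sinh x) has_real_derivative g x / (sinh x)\<^sup>2) (at x)"
      unfolding g_def using x uv
      by (auto intro!: derivative_eq_intros simp: power2_eq_square mult_ac)
    moreover have "0 \<le> g x / (sinh x)\<^sup>2" using g[of x] x uv by simp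
    ultimately show "\<exists>d. ((\<lambda>x. sinh (c * x) / sinh x) has_real_derivative d) (at x) \<and> 0 \<le> d" by blast
  qed
  thus ?thesis using uv by (simp add: field_simps)
qed

text \<open>Half-angle formula, by which the comparisons of cosh - 1 become squares of the sinh
  inequalities.\<close>

lemma cosh_minus_1: "cosh x - 1 = 2 * (sinh (x / 2))\<^sup>2" for x :: real
  using cosh_double[of "x / 2"] cosh_square_eq[of "x / 2"] by simp

lemma cosh_minus_1_ge:
  fixes \<alpha> \<beta> s :: real
  assumes "0 < \<alpha>" "\<alpha> \<le> \<beta>"
  shows "(\<beta> / \<alpha>)\<^sup>2 * (cosh (\<alpha> * s) - 1) \<le> cosh (\<beta> * s) - 1"
proof -
  have *: "(\<beta> / \<alpha>)\<^sup>2 * (cosh (\<alpha> * t) - 1) \<le> cosh (\<beta> * t) - 1" if "0 \<le> t" for t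
  proof -
    have "\<beta> / \<alpha> * sinh (\<alpha> * t / 2) \<le> sinh (\<beta> / \<alpha> * (\<alpha> * t / 2))"
      using assms that by (intro sinh_mult_ge) auto
    hence "(\<beta> / \<alpha> * sinh (\<alpha> * t / 2))\<^sup>2 \<le> (sinh (\<beta> * t / 2))\<^sup>2"
      using assms that by (intro power_mono) auto
    thus ?thesis unfolding cosh_minus_1 power_mult_distrib by simp
  qed
  show ?thesis using *[of s] *[of "- s"] by (cases "0 \<le> s") simp_all
qed

lemma cosh_minus_1_cross_le:
  fixes \<alpha> \<beta> s t :: real
  assumes "0 < \<alpha>" "\<alpha> \<le> \<beta>" "0 < s" "s \<le> t"
  shows "(cosh (\<beta> * s) - 1) * (cosh (\<alpha> * t) - 1) \<le> (cosh (\<beta> * t) - 1) * (cosh (\<alpha> * s) - 1)"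
proof -
  have "sinh (\<beta> / \<alpha> * (\<alpha> * s / 2)) * sinh (\<alpha> * t / 2) \<le> sinh (\<beta> / \<alpha> * (\<alpha> * t / 2)) * sinh (\<alpha> * s / 2)"
    using assms by (intro sinh_mult_cross_le) auto
  hence "(sinh (\<beta> * s / 2) * sinh (\<alpha> * t / 2))\<^sup>2 \<le> (sinh (\<beta> * t / 2) * sinh (\<alpha> * s / 2))\<^sup>2"
    using assms by (intro power_mono) auto
  thus ?thesis unfolding cosh_minus_1 power_mult_distrib by (simp add: mult_ac)
qed

text \<open>Concavity of sin on [0, pi] along the chord starting at 0, obtained here by
  differentiating in b.\<close>

lemma sin_mult_ge:
  fixes \<tau> b :: real
  assumes "0 \<le> \<tau>" "\<tau> \<le> 1" "0 \<le> b" "b \<le> pi"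
  shows "\<tau> * sin b \<le> sin (\<tau> * b)"
proof -
  have "sin (\<tau> * 0) - \<tau> * sin 0 \<le> sin (\<tau> * b) - \<tau> * sin b"
  proof (rule DERIV_nonneg_imp_nondecreasing[OF assms(3)])
    fix x :: real assume x: "0 \<le> x" "x \<le> b"
    have "((\<lambda>x. sin (\<tau> * x) - \<tau> * sin x) has_real_derivative \<tau> * (cos (\<tau> * x) - cos x)) (at x)"
      by (auto intro!: derivative_eq_intros simp: algebra_simps)
    moreover have "\<tau> * x \<le> x" using mult_right_mono[OF assms(2) x(1)] by simp
    hence "cos x \<le> cos (\<tau> * x)" using x assms by (intro cos_monotone_0_pi_le) auto
    hence "0 \<le> \<tau> * (cos (\<tau> * x) - cos x)" using assms by simp
    ultimately show "\<exists>y. ((\<lambda>x. sin (\<tau> * x) - \<tau> * sin x) has_real_derivative y) (at x) \<and> 0 \<le> y" by blast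
  qed
  thus ?thesis by simp
qed

section \<open>Sign of the difference of two kernels\<close>

definition kernel_num :: "real \<Rightarrow> real \<Rightarrow> real \<Rightarrow> real" where
  "kernel_num \<alpha> \<beta> s = sin (pi * \<alpha>) * (cosh (\<beta> * s) - cos (pi * \<beta>)) - sin (pi * \<beta>) * (cosh (\<alpha> * s) - cos (pi * \<alpha>))"

lemma ml_kernel_diff:
  assumes "0 < \<alpha>" "\<alpha> < 2" "0 < \<beta>" "\<beta> < 2"
  shows "ml_kernel \<alpha> s - ml_kernel \<beta> s =
    kernel_num \<alpha> \<beta> s / (2 * pi * ((cosh (\<alpha> * s) - cos (pi * \<alpha>)) * (cosh (\<beta> * s) - cos (pi * \<beta>))))"
  using ml_kernel_denom_pos[OF assms(1,2), of s] ml_kernel_denom_pos[OF assms(3,4), of s]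
  unfolding ml_kernel_def kernel_num_def by (simp add: divide_simps)

lemma ml_kernel_le_iff:
  assumes "0 < \<alpha>" "\<alpha> < 2" "0 < \<beta>" "\<beta> < 2"
  shows "ml_kernel \<beta> s \<le> ml_kernel \<alpha> s \<longleftrightarrow> 0 \<le> kernel_num \<alpha> \<beta> s"
    and "ml_kernel \<alpha> s \<le> ml_kernel \<beta> s \<longleftrightarrow> kernel_num \<alpha> \<beta> s \<le> 0"
proof -
  let ?D = "2 * pi * ((cosh (\<alpha> * s) - cos (pi * \<alpha>)) * (cosh (\<beta> * s) - cos (pi * \<beta>)))"
  have D: "0 < ?D"
    using ml_kernel_denom_pos[OF assms(1,2), of s] ml_kernel_denom_pos[OF assms(3,4), of s] by simp
  have "0 \<le> kernel_num \<alpha> \<beta> s / ?D \<longleftrightarrow> 0 \<le> kernel_num \<alpha> \<beta> s"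
    using D by (simp only: zero_le_divide_iff) linarith
  moreover have "kernel_num \<alpha> \<beta> s / ?D \<le> 0 \<longleftrightarrow> kernel_num \<alpha> \<beta> s \<le> 0"
    using D by (simp only: divide_le_0_iff) linarith
  ultimately show "ml_kernel \<beta> s \<le> ml_kernel \<alpha> s \<longleftrightarrow> 0 \<le> kernel_num \<alpha> \<beta> s"
    and "ml_kernel \<alpha> s \<le> ml_kernel \<beta> s \<longleftrightarrow> kernel_num \<alpha> \<beta> s \<le> 0"
    unfolding ml_kernel_diff[OF assms, symmetric] by linarith+
qed

text \<open>In half-angles a = pi \<alpha> / 2 and b = pi \<beta> / 2 the value is 4 sin a sin b sin
  (b - a), and all three angles lie in (0, pi).\<close>

lemma kernel_num_0_pos:
  assumes "0 < \<alpha>" "\<alpha> < \<beta>" "\<beta> < 2"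
  shows "0 < kernel_num \<alpha> \<beta> 0"
proof -
  define a b where "a = pi * \<alpha> / 2" and "b = pi * \<beta> / 2"
  have ab: "0 < a" "a < b" "b < pi" using assms by (auto simp: a_def b_def)
  have e: "pi * \<alpha> = 2 * a" "pi * \<beta> = 2 * b" by (simp_all add: a_def b_def)
  have "kernel_num \<alpha> \<beta> 0 = 4 * sin a * sin b * sin (b - a)"
    unfolding kernel_num_def e sin_double cos_double_sin sin_diff
    by (simp add: power2_eq_square algebra_simps)
  moreover have "0 < sin a" "0 < sin b" "0 < sin (b - a)" using ab by (auto intro!: sin_gt_zero)
  ultimately show ?thesis by simp
qed

text \<open>Splitting off the value at 0, whose sign is known, leaves only multiples of cosh - 1 to
  compare.\<close>

lemma kernel_num_decomp:
  "kernel_num \<alpha> \<beta> s = sin (pi * \<alpha>) * (cosh (\<beta> * s) - 1) - sin (pi * \<beta>) * (cosh (\<alpha> * s) - 1) + kernel_num \<alpha> \<beta> 0"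
  by (simp add: kernel_num_def algebra_simps)

text \<open>Put q = \<beta> / \<alpha>. Then sin (pi \<alpha>) is at least sin (pi \<beta>) / q by
  concavity, while cosh (\<beta> s) - 1 is at least q^2 times cosh (\<alpha> s) - 1. The product of
  the two gains the factor q \<ge> 1.\<close>

lemma ml_kernel_antimono:
  assumes "0 < \<alpha>" "\<alpha> < \<beta>" "\<beta> \<le> 1"
  shows "ml_kernel \<beta> s \<le> ml_kernel \<alpha> s"
proof -
  have "\<alpha> / \<beta> * sin (pi * \<beta>) \<le> sin (\<alpha> / \<beta> * (pi * \<beta>))"
    using assms by (intro sin_mult_ge) auto
  hence s1: "\<alpha> / \<beta> * sin (pi * \<beta>) \<le> sin (pi * \<alpha>)" using assms by (simp add: mult.commute)
  have b: "0 \<le> sin (pi * \<beta>)" using assms by (intro sin_ge_zero) auto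
  have Q: "0 \<le> cosh (\<alpha> * s) - 1" using cosh_real_ge_1[of "\<alpha> * s"] by simp
  have P: "(\<beta> / \<alpha>)\<^sup>2 * (cosh (\<alpha> * s) - 1) \<le> cosh (\<beta> * s) - 1"
    using assms by (intro cosh_minus_1_ge) auto
  have "sin (pi * \<beta>) * (cosh (\<alpha> * s) - 1) \<le> \<beta> / \<alpha> * (sin (pi * \<beta>) * (cosh (\<alpha> * s) - 1))"
    using mult_right_mono[of 1 "\<beta> / \<alpha>" "sin (pi * \<beta>) * (cosh (\<alpha> * s) - 1)"] assms b Q by simp
  also have "\<dots> = \<alpha> / \<beta> * sin (pi * \<beta>) * ((\<beta> / \<alpha>)\<^sup>2 * (cosh (\<alpha> * s) - 1))"
    using assms by (simp add: power2_eq_square)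
  also have "\<dots> \<le> sin (pi * \<alpha>) * (cosh (\<beta> * s) - 1)"
    using s1 P b Q assms by (intro mult_mono) (auto intro: order_trans[OF _ s1])
  finally have "0 \<le> kernel_num \<alpha> \<beta> s"
    using kernel_num_0_pos[of \<alpha> \<beta>] assms unfolding kernel_num_decomp[of \<alpha> \<beta> s] by simp
  thus ?thesis using assms by (subst ml_kernel_le_iff) auto
qed

text \<open>Both sines are negative, and the numerator becomes - (A P - B Q - D) with A, B, D > 0.
  As P / Q increases and D / Q decreases on s > 0, the quotient (A P - B Q - D) / Q increases there,
  so its sign changes only once. The estimates \<open>ge\<close> and \<open>le\<close> express this
  without division.\<close>

lemma ml_kernel_crossing:
  assumes "1 < \<alpha>" "\<alpha> < \<beta>" "\<beta> < 2"
  obtains s0 where "0 < s0" "\<And>s. \<bar>s\<bar> \<le> s0 \<Longrightarrow> ml_kernel \<beta> s \<le> ml_kernel \<alpha> s"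
    "\<And>s. s0 \<le> \<bar>s\<bar> \<Longrightarrow> ml_kernel \<alpha> s \<le> ml_kernel \<beta> s"
proof -
  define A B D where "A = - sin (pi * \<alpha>)" and "B = - sin (pi * \<beta>)" and "D = kernel_num \<alpha> \<beta> 0"
  have D: "0 < D" unfolding D_def using assms by (intro kernel_num_0_pos) auto
  have neg_sin: "0 < - sin (pi * \<gamma>)" if "1 < \<gamma>" "\<gamma> < 2" for \<gamma>
  proof -
    have "0 < sin (pi * \<gamma> - pi)" using that by (intro sin_gt_zero) (auto simp: algebra_simps)
    thus ?thesis by (simp add: sin_diff)
  qed
  have A: "0 < A" and B: "0 < B" unfolding A_def B_def using neg_sin assms by auto
  define P Q where "P s = cosh (\<beta> * s) - 1" and "Q s = cosh (\<alpha> * s) - 1" for s :: real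
  have num: "kernel_num \<alpha> \<beta> s = - (A * P s - B * Q s - D)" for s
    unfolding kernel_num_decomp[of \<alpha> \<beta> s] A_def B_def D_def P_def Q_def by (simp add: algebra_simps)
  have PQ: "0 \<le> P s" "0 \<le> Q s" for s using cosh_real_ge_1 by (simp_all add: P_def Q_def)
  have Q_pos: "0 < Q s" if "0 < s" for s
    using cosh_real_strict_mono[of 0 "\<alpha> * s"] that assms by (simp add: Q_def)
  have Q_mono: "Q s \<le> Q t" if "0 \<le> s" "s \<le> t" for s t
    using that assms by (simp add: Q_def cosh_real_nonneg_le_iff)
  have cross: "P s * Q t \<le> P t * Q s" if "0 < s" "s \<le> t" for s t
    unfolding P_def Q_def using assms that by (intro cosh_minus_1_cross_le) auto
  \<comment> \<open>Since \<beta> > \<alpha>, the term with P dominates for large s; at s = 0 the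
    expression is - D < 0, so the intermediate value theorem supplies \<open>s0\<close>.\<close>
  have "filterlim (\<lambda>s. A * P s - B * Q s - D) at_top at_top"
    unfolding P_def Q_def cosh_field_def using A B assms by real_asymp
  hence "\<forall>\<^sub>F s in at_top. 0 < A * P s - B * Q s - D" unfolding filterlim_at_top_dense by blast
  hence "\<forall>\<^sub>F s in at_top. 0 < s \<and> 0 < A * P s - B * Q s - D"
    using eventually_gt_at_top[of 0] by (rule eventually_conj[rotated])
  then obtain S where S: "0 < S" "0 < A * P S - B * Q S - D"
    using eventually_happens[of _ "at_top :: real filter"] by auto
  have "\<exists>x\<ge>0. x \<le> S \<and> A * P x - B * Q x - D = 0"
    using D S by (intro IVT) (auto simp: P_def Q_def intro!: continuous_intros)
  then obtain s0 where s0: "0 \<le> s0" "A * P s0 - B * Q s0 - D = 0" by blast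
  have "s0 \<noteq> 0" using s0 D by (auto simp: P_def Q_def)
  with s0 have s0_pos: "0 < s0" by simp
  have ge: "0 \<le> A * P t - B * Q t - D" if "s0 \<le> t" for t
  proof -
    have "(B * Q s0 + D) * Q t = A * P s0 * Q t" using s0 by simp
    also have "\<dots> \<le> A * P t * Q s0" using cross[OF s0_pos that] A by (simp add: mult.assoc)
    finally have "D * Q t \<le> (A * P t - B * Q t) * Q s0" by (simp add: algebra_simps)
    moreover have "D * Q s0 \<le> D * Q t" using D Q_mono[of s0 t] s0 that by simp
    ultimately have "D * Q s0 \<le> (A * P t - B * Q t) * Q s0" by linarith
    thus ?thesis using Q_pos[OF s0_pos] by (simp add: mult_le_cancel_right)
  qed
  have le: "A * P t - B * Q t - D \<le> 0" if "0 \<le> t" "t \<le> s0" for t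
  proof (cases "t = 0")
    case False
    hence "A * P t * Q s0 \<le> A * P s0 * Q t" using cross[of t s0] that A by (simp add: mult.assoc)
    also have "\<dots> = (B * Q s0 + D) * Q t" using s0 by simp
    finally have "(A * P t - B * Q t) * Q s0 \<le> D * Q t" by (simp add: algebra_simps)
    also have "\<dots> \<le> D * Q s0" using D Q_mono[of t s0] that by simp
    finally show ?thesis using Q_pos[OF s0_pos] by (simp add: mult_le_cancel_right)
  qed (use D in \<open>auto simp: P_def Q_def\<close>)
  have abs: "kernel_num \<alpha> \<beta> s = kernel_num \<alpha> \<beta> \<bar>s\<bar>" for s
    by (cases "0 \<le> s") (auto simp: kernel_num_def)
  show ?thesis
  proof (rule that[OF s0_pos])
    show "ml_kernel \<beta> s \<le> ml_kernel \<alpha> s" if "\<bar>s\<bar> \<le> s0" for s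
    proof -
      have "0 \<le> kernel_num \<alpha> \<beta> s" using le[of "\<bar>s\<bar>"] that abs[of s] num[of "\<bar>s\<bar>"] by linarith
      thus ?thesis using assms by (subst ml_kernel_le_iff(1)) auto
    qed
    show "ml_kernel \<alpha> s \<le> ml_kernel \<beta> s" if "s0 \<le> \<bar>s\<bar>" for s
    proof -
      have "kernel_num \<alpha> \<beta> s \<le> 0" using ge[OF that] abs[of s] num[of "\<bar>s\<bar>"] by linarith
      thus ?thesis using assms by (subst ml_kernel_le_iff(2)) auto
    qed
  qed
qed

section \<open>Monotonicity\<close>

text \<open>To first order the functions are 1 + \<epsilon>^\<alpha> / Gamma (1 + \<alpha>) and 1 +
  \<epsilon>^\<beta> / Gamma (1 + \<beta>), and \<epsilon>^\<beta> is of smaller order than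
  \<epsilon>^\<alpha>. Later terms are dropped on the \<alpha> side and majorized on the \<beta>
  side.\<close>

lemma mittag_leffler_less_near_0:
  fixes \<alpha> \<beta> x :: real
  assumes "0 < \<alpha>" "\<alpha> < \<beta>" "0 < x"
  obtains \<epsilon> where "0 < \<epsilon>" "\<epsilon> < x" "mittag_leffler \<beta> (\<epsilon> powr \<beta>) < mittag_leffler \<alpha> (\<epsilon> powr \<alpha>)"
proof -
  define c where "c \<gamma> n = 1 / Gamma (1 + real n * \<gamma>)" for \<gamma> :: real and n
  have c_pos: "0 < c \<gamma> n" if "0 < \<gamma>" for \<gamma> n
    using Gamma_one_plus_pos[OF that] by (simp add: c_def)
  have c_0: "c \<gamma> 0 = 1" for \<gamma> by (simp add: c_def)
  have summ: "summable (\<lambda>n. z ^ n * c \<gamma> n)" if "0 < \<gamma>" "0 \<le> z" for \<gamma> z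
    using summable_mittag_leffler_nonneg[OF that] by (simp add: c_def)
  have ml: "mittag_leffler \<gamma> z = (\<Sum>n. z ^ n * c \<gamma> n)" for \<gamma> z
    by (simp add: mittag_leffler_def c_def)
  have lower: "1 + z * c \<alpha> 1 \<le> mittag_leffler \<alpha> z" if "0 \<le> z" for z
  proof -
    have "(\<Sum>n<2. z ^ n * c \<alpha> n) \<le> mittag_leffler \<alpha> z"
      unfolding ml using that c_pos[of \<alpha>] assms by (intro sum_le_suminf summ) (auto simp: less_imp_le)
    thus ?thesis by (simp add: numeral_2_eq_2 c_0)
  qed
  \<comment> \<open>For z in [0, 1] every positive power of z is at most z, so z times this sum of
    coefficients bounds the whole tail.\<close>
  define M where "M = (\<Sum>n. c \<beta> (Suc n))"
  have s1: "summable (\<lambda>n. c \<beta> (Suc n))"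
    using summ[of \<beta> 1] assms by (subst summable_Suc_iff) simp
  have M: "0 < M" unfolding M_def using c_pos[of \<beta>] assms by (intro suminf_pos s1) auto
  have upper: "mittag_leffler \<beta> z \<le> 1 + z * M" if "0 \<le> z" "z \<le> 1" for z
  proof -
    have "mittag_leffler \<beta> z = (\<Sum>n. z ^ Suc n * c \<beta> (Suc n)) + 1"
      unfolding ml using suminf_split_head[OF summ[of \<beta> z]] assms that by (simp add: c_0)
    also have "(\<Sum>n. z ^ Suc n * c \<beta> (Suc n)) \<le> (\<Sum>n. z * c \<beta> (Suc n))"
    proof (intro suminf_le)
      show "summable (\<lambda>n. z ^ Suc n * c \<beta> (Suc n))"
        by (subst summable_Suc_iff, rule summ) (use assms that in auto)
      show "summable (\<lambda>n. z * c \<beta> (Suc n))" by (intro summable_mult s1)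
      show "z ^ Suc n * c \<beta> (Suc n) \<le> z * c \<beta> (Suc n)" for n
        using power_decreasing[of 1 "Suc n" z] that c_pos[of \<beta> "Suc n"] assms
        by (intro mult_right_mono) auto
    qed
    also have "\<dots> = z * M" unfolding M_def by (rule suminf_mult[OF s1])
    finally show ?thesis by simp
  qed
  have "((\<lambda>e :: real. e powr (\<beta> - \<alpha>)) \<longlongrightarrow> 0) (at_right 0)"
    using assms by real_asymp
  hence ev1: "\<forall>\<^sub>F e in at_right 0. e powr (\<beta> - \<alpha>) < c \<alpha> 1 / M"
    using c_pos[OF assms(1), of 1] M by (intro order_tendstoD) auto
  have ev2: "\<forall>\<^sub>F e in at_right (0 :: real). 0 < e \<and> e < min x 1"
    using eventually_at_right_real[of 0 "min x 1"] assms by simp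
  obtain \<epsilon> where \<epsilon>: "\<epsilon> powr (\<beta> - \<alpha>) < c \<alpha> 1 / M" "0 < \<epsilon>" "\<epsilon> < min x 1"
    using eventually_happens'[OF _ eventually_conj[OF ev1 ev2]] by auto
  have "\<epsilon> powr \<beta> * M = \<epsilon> powr \<alpha> * (\<epsilon> powr (\<beta> - \<alpha>) * M)"
    by (simp add: powr_add [symmetric] mult.assoc [symmetric])
  also have "\<dots> < \<epsilon> powr \<alpha> * c \<alpha> 1"
    using \<epsilon> M by (intro mult_strict_left_mono) (auto simp: pos_less_divide_eq)
  finally have "1 + \<epsilon> powr \<beta> * M < 1 + \<epsilon> powr \<alpha> * c \<alpha> 1" by simp
  moreover have "mittag_leffler \<beta> (\<epsilon> powr \<beta>) \<le> 1 + \<epsilon> powr \<beta> * M"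
    using \<epsilon> assms by (intro upper) (auto intro!: powr_le1)
  moreover have "1 + \<epsilon> powr \<alpha> * c \<alpha> 1 \<le> mittag_leffler \<alpha> (\<epsilon> powr \<alpha>)"
    by (intro lower) simp
  ultimately show ?thesis using that[of \<epsilon>] \<epsilon> by simp
qed

section \<open>From the order of the kernels to the order of the functions\<close>

lemma mittag_leffler_diff:
  assumes "0 < \<alpha>" "\<alpha> < 2" "0 < \<beta>" "\<beta> < 2" "0 \<le> x"
  shows "integrable lborel (\<lambda>s. exp (- x * exp s) * (ml_kernel \<beta> s - ml_kernel \<alpha> s))"
    and "mittag_leffler \<alpha> (x powr \<alpha>) - mittag_leffler \<beta> (x powr \<beta>) =
      (1 / \<alpha> - 1 / \<beta>) * exp x + (\<integral>s. exp (- x * exp s) * (ml_kernel \<beta> s - ml_kernel \<alpha> s) \<partial>lborel)"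
proof -
  have i: "integrable lborel (\<lambda>s. exp (- x * exp s) * ml_kernel \<alpha> s)"
          "integrable lborel (\<lambda>s. exp (- x * exp s) * ml_kernel \<beta> s)"
    using assms by (auto intro!: integrable_exp_ml_kernel[simplified])
  show "integrable lborel (\<lambda>s. exp (- x * exp s) * (ml_kernel \<beta> s - ml_kernel \<alpha> s))"
    unfolding right_diff_distrib by (intro Bochner_Integration.integrable_diff i)
  have "(\<integral>s. exp (- x * exp s) * (ml_kernel \<beta> s - ml_kernel \<alpha> s) \<partial>lborel) = kernel_laplace \<beta> x - kernel_laplace \<alpha> x"
    unfolding right_diff_distrib kernel_laplace_def by (intro Bochner_Integration.integral_diff i)
  thus "mittag_leffler \<alpha> (x powr \<alpha>) - mittag_leffler \<beta> (x powr \<beta>) =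
      (1 / \<alpha> - 1 / \<beta>) * exp x + (\<integral>s. exp (- x * exp s) * (ml_kernel \<beta> s - ml_kernel \<alpha> s) \<partial>lborel)"
    using mittag_leffler_representation[OF assms(1,2,5)] mittag_leffler_representation[OF assms(3,4,5)]
    by (simp add: left_diff_distrib)
qed

text \<open>At x = 0 the atom and the integral cancel. Passing to x > 0 shrinks the weights on a
  nonpositive density, so the integral does not decrease, while the atom grows strictly.\<close>

lemma mittag_leffler_less_if_kernel_le:
  assumes "0 < \<alpha>" "\<alpha> < \<beta>" "\<beta> < 2" "0 < x" and le: "\<And>s. ml_kernel \<beta> s \<le> ml_kernel \<alpha> s"
  shows "mittag_leffler \<beta> (x powr \<beta>) < mittag_leffler \<alpha> (x powr \<alpha>)"
proof -
  let ?c = "1 / \<alpha> - 1 / \<beta>" and ?d = "\<lambda>s. ml_kernel \<beta> s - ml_kernel \<alpha> s"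
  have c: "0 < ?c" using assms by (simp add: field_simps)
  have "(\<integral>s. exp (- 0 * exp s) * ?d s \<partial>lborel) \<le> (\<integral>s. exp (- x * exp s) * ?d s \<partial>lborel)"
  proof (rule integral_mono)
    show "integrable lborel (\<lambda>s. exp (- 0 * exp s) * ?d s)"
      using assms by (intro mittag_leffler_diff) auto
    show "integrable lborel (\<lambda>s. exp (- x * exp s) * ?d s)"
      using assms by (intro mittag_leffler_diff) auto
    show "exp (- 0 * exp s) * ?d s \<le> exp (- x * exp s) * ?d s" for s
      using assms le[of s] by (intro mult_right_mono_neg) auto
  qed
  moreover have "?c + (\<integral>s. exp (- 0 * exp s) * ?d s \<partial>lborel) = 0"
    using mittag_leffler_diff(2)[of \<alpha> \<beta> 0] assms by (simp add: mittag_leffler_0)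
  moreover have "?c < ?c * exp x" using c assms by simp
  ultimately show ?thesis
    using mittag_leffler_diff(2)[of \<alpha> \<beta> x] assms by linarith
qed

lemma mittag_leffler_less_if_kernel_crosses:
  assumes "0 < \<alpha>" "\<alpha> < \<beta>" "\<beta> < 2" "0 < x" and "0 < s0"
    and inner: "\<And>s. \<bar>s\<bar> \<le> s0 \<Longrightarrow> ml_kernel \<beta> s \<le> ml_kernel \<alpha> s"
    and outer: "\<And>s. s0 \<le> \<bar>s\<bar> \<Longrightarrow> ml_kernel \<alpha> s \<le> ml_kernel \<beta> s"
  shows "mittag_leffler \<beta> (x powr \<beta>) < mittag_leffler \<alpha> (x powr \<alpha>)"
proof -
  obtain \<epsilon> where \<epsilon>: "0 < \<epsilon>" "\<epsilon> < x" and near: "mittag_leffler \<beta> (\<epsilon> powr \<beta>) < mittag_leffler \<alpha> (\<epsilon> powr \<alpha>)"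
    using mittag_leffler_less_near_0[of \<alpha> \<beta> x] assms by blast
  define \<phi> where "\<phi> t = mittag_leffler \<alpha> (t powr \<alpha>) - mittag_leffler \<beta> (t powr \<beta>)" for t
  define c where "c = 1 / \<alpha> - 1 / \<beta>"
  define d where "d s = ml_kernel \<beta> s - ml_kernel \<alpha> s" for s
  have c: "0 < c" using assms by (simp add: c_def field_simps)
  have int: "integrable lborel (\<lambda>s. exp (- t * exp s) * d s)"
    and \<phi>: "\<phi> t = c * exp t + (\<integral>s. exp (- t * exp s) * d s \<partial>lborel)" if "0 \<le> t" for t
    unfolding \<phi>_def c_def d_def using assms that by (auto intro!: mittag_leffler_diff[simplified] mittag_leffler_diff)
  have \<phi>0: "\<phi> 0 = 0" by (simp add: \<phi>_def mittag_leffler_0)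
  \<comment> \<open>The power k = x / \<epsilon> turns exp (\<epsilon> t) into exp (x t); it is at
    least 1, which makes \<psi> convex.\<close>
  define k where "k = x / \<epsilon>"
  define \<psi> where "\<psi> y = y powr k" for y :: real
  have k: "1 \<le> k" using \<epsilon> by (simp add: k_def)
  have \<psi>_exp: "\<psi> (exp (\<epsilon> * t)) = exp (x * t)" for t
    using \<epsilon> by (simp add: \<psi>_def k_def powr_def)
  have conv: "convex_on {0<..} \<psi>" unfolding \<psi>_def using k by (rule powr_convex)
  \<comment> \<open>The order is reversed: \<open>y1\<close> belongs to s = s0 and \<open>y2\<close>
    to s = - s0, as y decreases in s.\<close>
  define y1 y2 where "y1 = exp (\<epsilon> * - exp s0)" and "y2 = exp (\<epsilon> * - exp (- s0))"
  have y: "0 < y1" "y1 < y2" "y2 < 1" using \<epsilon> assms(5) by (auto simp: y1_def y2_def)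
  define m where "m = (\<psi> y2 - \<psi> y1) / (y2 - y1)"
  define a where "a = \<psi> y1 - m * y1"
  have m: "0 < m" unfolding m_def \<psi>_def using y k by (intro divide_pos_pos) (auto intro!: powr_less_mono2)
  have above: "a + m * y \<le> \<psi> y" if "0 < y" "y \<le> y1 \<or> y2 \<le> y" for y
    using convex_on_ge_chord[OF conv, of y1 y2 y] that \<open>0 < y1\<close> \<open>y1 < y2\<close>
    unfolding a_def m_def[symmetric] by (simp add: algebra_simps)
  have below: "\<psi> y \<le> a + m * y" if "y1 \<le> y" "y \<le> y2" for y
    using convex_on_le_chord[OF conv, of y1 y2 y] that \<open>0 < y1\<close> \<open>y1 < y2\<close>
    unfolding a_def m_def[symmetric] by (simp add: algebra_simps subset_iff)
  \<comment> \<open>Between the crossing points the chord lies above \<psi> and d \<le> 0; outside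
    them the chord lies below and d \<ge> 0. Multiplying by d gives the same inequality in both
    regions.\<close>
  have pointwise: "a * (exp (- 0 * exp s) * d s) + m * (exp (- \<epsilon> * exp s) * d s) \<le> exp (- x * exp s) * d s" for s
  proof -
    let ?y = "exp (\<epsilon> * - exp s)"
    have le1: "y1 \<le> ?y \<longleftrightarrow> s \<le> s0" and le2: "?y \<le> y2 \<longleftrightarrow> - s0 \<le> s"
      and le3: "?y \<le> y1 \<longleftrightarrow> s0 \<le> s" and le4: "y2 \<le> ?y \<longleftrightarrow> s \<le> - s0"
      using \<epsilon> by (simp_all add: y1_def y2_def)
    have "(a + m * ?y) * d s \<le> \<psi> ?y * d s"
    proof (cases "\<bar>s\<bar> \<le> s0")
      case True
      hence "y1 \<le> ?y" "?y \<le> y2" unfolding le1 le2 by linarith+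
      hence "\<psi> ?y \<le> a + m * ?y" by (rule below)
      moreover have "d s \<le> 0" using inner[OF True] by (simp add: d_def)
      ultimately show ?thesis by (intro mult_right_mono_neg)
    next
      case False
      hence "?y \<le> y1 \<or> y2 \<le> ?y" unfolding le3 le4 by linarith
      hence "a + m * ?y \<le> \<psi> ?y" by (intro above) simp_all
      moreover have "0 \<le> d s" using outer[of s] False by (simp add: d_def)
      ultimately show ?thesis by (intro mult_right_mono)
    qed
    thus ?thesis unfolding \<psi>_exp by (simp add: algebra_simps)
  qed
  \<comment> \<open>Integrating the chord against the whole signed measure gives this combination;
    the constant part a disappears because the total mass is zero.\<close>
  have "m * \<phi> \<epsilon> = a * \<phi> 0 + m * \<phi> \<epsilon>" by (simp add: \<phi>0)
  also have "\<dots> = c * (a + m * exp \<epsilon>) +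
     (a * (\<integral>s. exp (- 0 * exp s) * d s \<partial>lborel) + m * (\<integral>s. exp (- \<epsilon> * exp s) * d s \<partial>lborel))"
    using \<epsilon> by (subst (1 2) \<phi>) (simp_all add: algebra_simps)
  also have "a * (\<integral>s. exp (- 0 * exp s) * d s \<partial>lborel) + m * (\<integral>s. exp (- \<epsilon> * exp s) * d s \<partial>lborel) =
     (\<integral>s. a * (exp (- 0 * exp s) * d s) + m * (exp (- \<epsilon> * exp s) * d s) \<partial>lborel)"
    using int[of 0] int[of \<epsilon>] \<epsilon> by (subst Bochner_Integration.integral_add) auto
  also have "\<dots> \<le> (\<integral>s. exp (- x * exp s) * d s \<partial>lborel)"
    using int[of 0] int[of \<epsilon>] int[of x] \<epsilon> by (intro integral_mono pointwise) auto
  \<comment> \<open>The atom r = -1 corresponds to y = exp \<epsilon> > 1 > y2, again outside the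
    chord, and its mass c is positive.\<close>
  also have "a + m * exp \<epsilon> \<le> exp x"
    using above[of "exp (\<epsilon> * 1)"] y \<epsilon> unfolding \<psi>_exp by (simp add: order.trans[OF less_imp_le[OF \<open>y2 < 1\<close>]])
  finally have "m * \<phi> \<epsilon> \<le> \<phi> x" using c \<epsilon> \<phi>[of x] by (simp add: mult_left_mono)
  moreover have "0 < m * \<phi> \<epsilon>" using m near by (simp add: \<phi>_def)
  ultimately show ?thesis by (simp add: \<phi>_def)
qed

theorem theoremA:
  fixes x :: real
  assumes "x > 0"
  shows "\<forall>\<alpha>\<in>{0<..<2}. \<forall>\<beta>\<in>{0<..<2}. \<alpha> < \<beta> \<longrightarrow>
           mittag_leffler \<beta> (x powr \<beta>) < mittag_leffler \<alpha> (x powr \<alpha>)"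
proof (intro ballI impI)
  fix \<alpha> \<beta> :: real
  assume \<alpha>: "\<alpha> \<in> {0<..<2}" and \<beta>: "\<beta> \<in> {0<..<2}" and less: "\<alpha> < \<beta>"
  show "mittag_leffler \<beta> (x powr \<beta>) < mittag_leffler \<alpha> (x powr \<alpha>)"
  proof (cases "1 < \<alpha>")
    case True
    obtain s0 where "0 < s0" "\<And>s. \<bar>s\<bar> \<le> s0 \<Longrightarrow> ml_kernel \<beta> s \<le> ml_kernel \<alpha> s"
        "\<And>s. s0 \<le> \<bar>s\<bar> \<Longrightarrow> ml_kernel \<alpha> s \<le> ml_kernel \<beta> s"
      using ml_kernel_crossing[of \<alpha> \<beta>] True less \<beta> by auto
    thus ?thesis
      using \<alpha> \<beta> less assms by (intro mittag_leffler_less_if_kernel_crosses) auto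
  next
    case False
    \<comment> \<open>When \<alpha> \<le> 1 the kernels are ordered on the whole line: by
      \<open>ml_kernel_antimono\<close> if \<beta> \<le> 1, and by their opposite signs
      otherwise.\<close>
    have "ml_kernel \<beta> s \<le> ml_kernel \<alpha> s" for s
    proof (cases "\<beta> \<le> 1")
      case True
      thus ?thesis using \<alpha> less by (intro ml_kernel_antimono) auto
    next
      case False
      have "ml_kernel \<beta> s \<le> 0" using False \<beta> by (intro ml_kernel_nonpos) auto
      also have "0 \<le> ml_kernel \<alpha> s" using \<open>\<not> 1 < \<alpha>\<close> \<alpha> by (intro ml_kernel_nonneg) auto
      finally show ?thesis .
    qed
    thus ?thesis
      using \<alpha> \<beta> less assms by (intro mittag_leffler_less_if_kernel_le) auto
  qed
qed

end
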